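(* Let $\{x_i\}_{i=1}^n\subset\mathbb{R}^d$, let $X=(x_1\ x_2\ \cdots\ x_n)\in\mathbb{R}^{d\times n}$, and suppose $A$ is a self-adjoint, positive semi-definite operator on $\ell^2=\ell^2(\mathbb{Z})$ with purely discrete spectrum. Then $$\sum_{i=1}^n \langle A \Phi(x_i), \Phi(x_i)\rangle_{\ell^2} \ \geq\ \sum_{i=1}^d \lambda_i(A)\,\sigma_i(X)^2$$ for all $\Phi\in\mathcal{I}$, and this lower bound is attained for all $\Phi$ of the form $$\Phi(x) = \sum_{i=1}^d (u_i^T x)\phi_i \qquad (x\in\mathbb{R}^d),\qquad (\ast)$$ where $\{u_i\}_{i=1}^d$ is an orthonormal basis of $\mathbb{R}^d$ consisting of left singular vectors of $X$, with $u_i$ corresponding to the singular value $\sigma_i(X)$, and $\{\phi_i\}_{i=1}^d\subset \ell^2$ is an orthonormal set of eigenvectors of $A$, with $\phi_i$ corresponding to the eigenvalue $\lambda_i(A)$. Moreover, if the singular values $\sigma_1(X),\dots,\sigma_d(X)$ are distinct and non-zero, then any minimizer $\Phi$ of $\sum_{i=1}^n \langle A \Phi(x_i), \Phi(x_i)\rangle_{\ell^2}$ over $\mathcal{I}$ satisfies $(\ast)$ with $\{\phi_i\}_{i=1}^d$ an orthonormal set of eigenvectors of $A$, with $\phi_i$ corresponding to the eigenvalue $\lambda_i(A)$.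
   Context: $\ell^2=\ell^2(\mathbb{Z})$ is the Hilbert space of complex square-summable sequences indexed by $\mathbb{Z}$, with inner product $\langle f,g\rangle_{\ell^2}=\sum_{k\in\mathbb{Z}} f[k]\overline{g[k]}$. $\mathcal{I}$ denotes the set of linear isometries $\Phi:\mathbb{R}^d\to\ell^2$, i.e. real-linear maps preserving inner products: $\langle\Phi(x),\Phi(y)\rangle_{\ell^2}=x^Ty$ for all $x,y\in\mathbb{R}^d$. $A$ is possibly unbounded, with domain $\mathrm{dom}(A)=\{f\in\ell^2: Af\in\ell^2\}$. Purely discrete spectrum means that the spectrum $\sigma(A)$ consists of isolated eigenvalues of finite multiplicity. $\lambda_1(A)\le\lambda_2(A)\le\cdots\le\lambda_d(A)$ denote the $d$ lowest eigenvalues of $A$, counted with multiplicity. For $f\in\ell^2$, $\langle Af,f\rangle_{\ell^2}\in[0,\infty]$ is understood as the value of the closed quadratic form of $A$, equal to $\|A^{1/2}f\|^2$ if $f\in\mathrm{dom}(A^{1/2})$ and $+\infty$ otherwise. $\sigma_1(X)\ge\cdots\ge\sigma_d(X)\ge 0$ are the singular values of $X$, i.e. the square roots of the $d$ eigenvalues of $XX^T$ with multiplicity; left singular vectors of $X$ corresponding to $\sigma_i(X)$ are eigenvectors of $XX^T$ with eigenvalue $\sigma_i(X)^2$. *)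

theory Defs
  imports "HOL-Analysis.Analysis"
begin

section \<open>The Hilbert space of square-summable sequences indexed by the integers\<close>

typedef ell2 = "{f :: int \<Rightarrow> complex. (\<lambda>k. (cmod (f k))\<^sup>2) summable_on UNIV}"
  morphisms seq Abs_ell2
  by (rule exI[of _ "\<lambda>_. 0"]) simp

setup_lifting type_definition_ell2

lemma seq_mult_abs_summable:
  assumes "(\<lambda>k. (cmod (f k))\<^sup>2) summable_on UNIV" "(\<lambda>k. (cmod (g k))\<^sup>2) summable_on UNIV"
  shows "(\<lambda>k::int. norm (f k * cnj (g k))) summable_on UNIV"
proof (rule summable_on_comparison_test)
  show "(\<lambda>k. (cmod (f k))\<^sup>2 + (cmod (g k))\<^sup>2) summable_on UNIV"
    using assms by (rule summable_on_add)
  show "norm (f k * cnj (g k)) \<le> (cmod (f k))\<^sup>2 + (cmod (g k))\<^sup>2" for k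
  proof -
    have "0 \<le> (cmod (f k) - cmod (g k))\<^sup>2" "0 \<le> cmod (f k) * cmod (g k)" by simp_all
    then show ?thesis
      unfolding norm_mult complex_mod_cnj power2_diff by linarith
  qed
qed simp

lemma seq_mult_summable:
  assumes "(\<lambda>k. (cmod (f k))\<^sup>2) summable_on UNIV" "(\<lambda>k. (cmod (g k))\<^sup>2) summable_on UNIV"
  shows "(\<lambda>k::int. f k * cnj (g k)) summable_on UNIV"
  using seq_mult_abs_summable[OF assms] by (rule abs_summable_summable)

lemma seq_add_summable:
  assumes "(\<lambda>k. (cmod (f k))\<^sup>2) summable_on UNIV" "(\<lambda>k. (cmod (g k))\<^sup>2) summable_on UNIV"
  shows "(\<lambda>k::int. (cmod (f k + g k))\<^sup>2) summable_on UNIV"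
proof (rule summable_on_comparison_test)
  show "(\<lambda>k. 2 * ((cmod (f k))\<^sup>2 + (cmod (g k))\<^sup>2)) summable_on UNIV"
    using assms by (intro summable_on_cmult_right summable_on_add)
  show "(cmod (f k + g k))\<^sup>2 \<le> 2 * ((cmod (f k))\<^sup>2 + (cmod (g k))\<^sup>2)" for k
  proof -
    have "(cmod (f k + g k))\<^sup>2 \<le> (cmod (f k) + cmod (g k))\<^sup>2"
      by (intro power_mono norm_triangle_ineq) simp
    moreover have "0 \<le> (cmod (f k) - cmod (g k))\<^sup>2" by simp
    ultimately show ?thesis by (simp add: power2_diff power2_sum)
  qed
qed simp

lemma seq_scale_summable:
  assumes "(\<lambda>k. (cmod (f k))\<^sup>2) summable_on UNIV"
  shows "(\<lambda>k::int. (cmod (c * f k))\<^sup>2) summable_on UNIV"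
  using summable_on_cmult_right[OF assms, of "(cmod c)\<^sup>2"]
  by (simp add: norm_mult power_mult_distrib)

instantiation ell2 :: ab_group_add
begin

lift_definition zero_ell2 :: ell2 is "\<lambda>_. 0" by simp
lift_definition plus_ell2 :: "ell2 \<Rightarrow> ell2 \<Rightarrow> ell2" is "\<lambda>f g k. f k + g k"
  by (rule seq_add_summable)
lift_definition uminus_ell2 :: "ell2 \<Rightarrow> ell2" is "\<lambda>f k. - f k" by simp
lift_definition minus_ell2 :: "ell2 \<Rightarrow> ell2 \<Rightarrow> ell2" is "\<lambda>f g k. f k - g k"
  subgoal for f g using seq_add_summable[of f "\<lambda>k. - g k"] by simp
  done

instance
  by standard (transfer; simp add: fun_eq_iff algebra_simps)+

end

lift_definition scaleC :: "complex \<Rightarrow> ell2 \<Rightarrow> ell2" (infixr "*\<^sub>C" 75) is "\<lambda>c f k. c * f k"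
  by (rule seq_scale_summable)

lift_definition cinner :: "ell2 \<Rightarrow> ell2 \<Rightarrow> complex" is "\<lambda>f g. \<Sum>\<^sub>\<infinity>k. f k * cnj (g k)" .

lemma cinner_add_left: "cinner (f + g) h = cinner f h + cinner g h"
  by transfer (simp add: ring_distribs infsum_add seq_mult_summable)

lemma cinner_scaleC_left: "cinner (c *\<^sub>C f) h = c * cinner f h"
  by transfer (simp add: mult.assoc infsum_cmult_right seq_mult_summable)

lemma cinner_commute: "cinner f g = cnj (cinner g f)"
  by transfer (simp flip: infsum_cnj add: mult.commute)

lemma cinner_self: "cinner f f = of_real (\<Sum>\<^sub>\<infinity>k. (cmod (seq f k))\<^sup>2)"
proof -
  have "((\<lambda>k. of_real ((cmod (seq f k))\<^sup>2)) has_sum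
      complex_of_real (\<Sum>\<^sub>\<infinity>k. (cmod (seq f k))\<^sup>2)) UNIV"
    using seq[of f] by (intro has_sum_of_real has_sum_infsum) simp
  then show ?thesis
    by (simp add: cinner.rep_eq infsumI flip: complex_norm_square)
qed

instantiation ell2 :: real_inner
begin

definition scaleR_ell2 :: "real \<Rightarrow> ell2 \<Rightarrow> ell2" where
  "scaleR_ell2 r f = of_real r *\<^sub>C f"
definition inner_ell2 :: "ell2 \<Rightarrow> ell2 \<Rightarrow> real" where
  "inner_ell2 f g = Re (cinner f g)"
definition norm_ell2 :: "ell2 \<Rightarrow> real" where
  "norm_ell2 f = sqrt (inner f f)"
definition dist_ell2 :: "ell2 \<Rightarrow> ell2 \<Rightarrow> real" where
  "dist_ell2 f g = norm (f - g)"
definition sgn_ell2 :: "ell2 \<Rightarrow> ell2" where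
  "sgn_ell2 f = inverse (norm f) *\<^sub>R f"
definition uniformity_ell2 :: "(ell2 \<times> ell2) filter" where
  "uniformity_ell2 = (INF e\<in>{0<..}. principal {(f, g). dist f g < e})"
definition open_ell2 :: "ell2 set \<Rightarrow> bool" where
  "open_ell2 U = (\<forall>f\<in>U. eventually (\<lambda>(f', g). f' = f \<longrightarrow> g \<in> U) uniformity)"

instance
proof
  fix f g h :: ell2 and r s :: real
  show "r *\<^sub>R (f + g) = r *\<^sub>R f + r *\<^sub>R g" "(r + s) *\<^sub>R f = r *\<^sub>R f + s *\<^sub>R f"
    "r *\<^sub>R s *\<^sub>R f = (r * s) *\<^sub>R f" "1 *\<^sub>R f = f"
    unfolding scaleR_ell2_def by (transfer; simp add: fun_eq_iff algebra_simps)+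
  show "inner f g = inner g f"
    unfolding inner_ell2_def by (subst cinner_commute) simp
  show "inner (f + g) h = inner f h + inner g h"
    unfolding inner_ell2_def by (simp add: cinner_add_left)
  show "inner (r *\<^sub>R f) g = r * inner f g"
    unfolding inner_ell2_def scaleR_ell2_def by (simp add: cinner_scaleC_left)
  show "0 \<le> inner f f"
    unfolding inner_ell2_def cinner_self by (simp add: infsum_nonneg)
  show "inner f f = 0 \<longleftrightarrow> f = 0"
  proof
    assume "inner f f = 0"
    then have "(\<Sum>\<^sub>\<infinity>k. (cmod (seq f k))\<^sup>2) = 0"
      unfolding inner_ell2_def cinner_self by simp
    then have "(cmod (seq f k))\<^sup>2 = 0" for k
      using nonneg_infsum_le_0D[of "\<lambda>k. (cmod (seq f k))\<^sup>2" UNIV k] seq[of f] by simp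
    then show "f = 0"
      by transfer (simp add: fun_eq_iff)
  next
    assume "f = 0"
    then show "inner f f = 0"
      unfolding inner_ell2_def by simp (transfer; simp)
  qed
qed (simp_all add: norm_ell2_def dist_ell2_def sgn_ell2_def uniformity_ell2_def open_ell2_def)

end

global_interpretation ell2: vector_space scaleC
  by standard (transfer; simp add: fun_eq_iff algebra_simps)+

section \<open>Unbounded operators\<close>

text \<open>A possibly unbounded operator is a partial function; its domain is \<^term>\<open>dom A\<close>,
  and \<^term>\<open>A f = Some h\<close> says that \<open>f\<close> lies in the domain and \<open>A f = h\<close>.
  The composition \<^term>\<open>B \<circ>\<^sub>m B\<close> has the domain usual for unbounded operators:
  those \<open>f\<close> in \<^term>\<open>dom B\<close> with \<open>B f\<close> in \<^term>\<open>dom B\<close>.\<close>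

definition linear_op :: "(ell2 \<rightharpoonup> ell2) \<Rightarrow> bool" where
  "linear_op A \<longleftrightarrow> A 0 = Some 0 \<and>
    (\<forall>f g f' g'. A f = Some f' \<and> A g = Some g' \<longrightarrow> A (f + g) = Some (f' + g')) \<and>
    (\<forall>c f f'. A f = Some f' \<longrightarrow> A (c *\<^sub>C f) = Some (c *\<^sub>C f'))"

text \<open>The vector \<open>h\<close> below is unique if \<^term>\<open>dom A\<close> is dense.\<close>

definition adjoint_op :: "(ell2 \<rightharpoonup> ell2) \<Rightarrow> (ell2 \<rightharpoonup> ell2)" where
  "adjoint_op A g =
    (if \<exists>h. \<forall>f\<in>dom A. cinner (the (A f)) g = cinner f h
     then Some (THE h. \<forall>f\<in>dom A. cinner (the (A f)) g = cinner f h)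
     else None)"

definition self_adjoint :: "(ell2 \<rightharpoonup> ell2) \<Rightarrow> bool" where
  "self_adjoint A \<longleftrightarrow> linear_op A \<and> closure (dom A) = UNIV \<and> adjoint_op A = A"

definition positive_semidefinite :: "(ell2 \<rightharpoonup> ell2) \<Rightarrow> bool" where
  "positive_semidefinite A \<longleftrightarrow> (\<forall>f\<in>dom A. cinner (the (A f)) f \<in> \<real>\<^sub>\<ge>\<^sub>0)"

text \<open>In the next definition \<open>R\<close> is the inverse of \<open>A - z\<close>, mapping onto \<^term>\<open>dom A\<close>.\<close>

definition resolvent_set :: "(ell2 \<rightharpoonup> ell2) \<Rightarrow> complex set" where
  "resolvent_set A = {z. \<exists>R. bounded_linear R \<and>
     (\<forall>f\<in>dom A. R (the (A f) - z *\<^sub>C f) = f) \<and>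
     (\<forall>g. R g \<in> dom A \<and> the (A (R g)) - z *\<^sub>C R g = g)}"

definition spectrum :: "(ell2 \<rightharpoonup> ell2) \<Rightarrow> complex set" where
  "spectrum A = - resolvent_set A"

definition eigenspace :: "(ell2 \<rightharpoonup> ell2) \<Rightarrow> complex \<Rightarrow> ell2 set" where
  "eigenspace A z = {f. A f = Some (z *\<^sub>C f)}"

definition is_eigenvalue :: "(ell2 \<rightharpoonup> ell2) \<Rightarrow> complex \<Rightarrow> bool" where
  "is_eigenvalue A z \<longleftrightarrow> (\<exists>f\<in>eigenspace A z. f \<noteq> 0)"

definition purely_discrete_spectrum :: "(ell2 \<rightharpoonup> ell2) \<Rightarrow> bool" where
  "purely_discrete_spectrum A \<longleftrightarrow> (\<forall>z\<in>spectrum A. z isolated_in spectrum A \<and>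
     is_eigenvalue A z \<and> (\<exists>B. finite B \<and> eigenspace A z \<subseteq> ell2.span B))"

text \<open>\<^term>\<open>ell2.dim\<close> is the complex dimension. The index set of the sum is finite if \<open>A\<close> is
  self-adjoint and positive semi-definite with purely discrete spectrum; then the \<open>i\<close>-th lowest
  eigenvalue (\<open>i \<ge> 1\<close>) is the least \<open>t\<close> such that at least \<open>i\<close> eigenvalues,
  counted with multiplicity, do not exceed \<open>t\<close>.\<close>

definition num_eigenvalues_le :: "(ell2 \<rightharpoonup> ell2) \<Rightarrow> real \<Rightarrow> nat" where
  "num_eigenvalues_le A t =
    (\<Sum>s | is_eigenvalue A (of_real s) \<and> s \<le> t. ell2.dim (eigenspace A (of_real s)))"

definition lowest_eigenvalue :: "(ell2 \<rightharpoonup> ell2) \<Rightarrow> nat \<Rightarrow> real" where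
  "lowest_eigenvalue A i = (LEAST t. i \<le> num_eigenvalues_le A t)"

definition sqrt_op :: "(ell2 \<rightharpoonup> ell2) \<Rightarrow> (ell2 \<rightharpoonup> ell2)" where
  "sqrt_op A = (THE B. self_adjoint B \<and> positive_semidefinite B \<and> B \<circ>\<^sub>m B = A)"

definition quadratic_form :: "(ell2 \<rightharpoonup> ell2) \<Rightarrow> ell2 \<Rightarrow> ennreal" where
  "quadratic_form A f =
    (case sqrt_op A f of Some h \<Rightarrow> ennreal ((norm h)\<^sup>2) | None \<Rightarrow> \<infinity>)"

section \<open>Singular values\<close>

text \<open>\<open>i \<ge> 1\<close>, and the \<open>i\<close>-th largest eigenvalue of \<open>X X\<^sup>T\<close> is the greatest \<open>t\<close> such that at
  least \<open>i\<close> eigenvalues, counted with multiplicity, are at least \<open>t\<close>. As \<open>X X\<^sup>T\<close> is symmetric,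
  geometric and algebraic multiplicities agree.\<close>

definition sym_eigenspace :: "real^'d^'d \<Rightarrow> real \<Rightarrow> (real^'d) set" where
  "sym_eigenspace M s = {v. M *v v = s *\<^sub>R v}"

definition num_eigenvalues_ge :: "real^'d^'d \<Rightarrow> real \<Rightarrow> nat" where
  "num_eigenvalues_ge M t =
    (\<Sum>s | (\<exists>v\<in>sym_eigenspace M s. v \<noteq> 0) \<and> t \<le> s. dim (sym_eigenspace M s))"

definition singular_value :: "real^'n^'d \<Rightarrow> nat \<Rightarrow> real" where
  "singular_value X i = sqrt (GREATEST t. i \<le> num_eigenvalues_ge (X ** transpose X) t)"

section \<open>The minimization problem\<close>

definition isometries :: "(real^'d \<Rightarrow> ell2) set" where
  "isometries = {\<Phi>. linear \<Phi> \<and> (\<forall>x y. cinner (\<Phi> x) (\<Phi> y) = of_real (x \<bullet> y))}"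

definition energy ::
    "(ell2 \<rightharpoonup> ell2) \<Rightarrow> ('n::finite \<Rightarrow> real^'d) \<Rightarrow> (real^'d \<Rightarrow> ell2) \<Rightarrow> ennreal" where
  "energy A x \<Phi> = (\<Sum>i\<in>UNIV. quadratic_form A (\<Phi> (x i)))"

definition left_singular_basis :: "real^'n^'d \<Rightarrow> (nat \<Rightarrow> real^'d) \<Rightarrow> bool" where
  "left_singular_basis X u \<longleftrightarrow>
    (\<forall>i\<in>{1..CARD('d)}. \<forall>j\<in>{1..CARD('d)}. u i \<bullet> u j = (if i = j then 1 else 0)) \<and>
    span (u ` {1..CARD('d)}) = UNIV \<and>
    (\<forall>i\<in>{1..CARD('d)}. (X ** transpose X) *v u i = (singular_value X i)\<^sup>2 *\<^sub>R u i)"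

definition lowest_eigenvectors :: "(ell2 \<rightharpoonup> ell2) \<Rightarrow> nat \<Rightarrow> (nat \<Rightarrow> ell2) \<Rightarrow> bool" where
  "lowest_eigenvectors A d \<phi> \<longleftrightarrow>
    (\<forall>i\<in>{1..d}. \<forall>j\<in>{1..d}. cinner (\<phi> i) (\<phi> j) = (if i = j then 1 else 0)) \<and>
    (\<forall>i\<in>{1..d}. \<phi> i \<in> eigenspace A (of_real (lowest_eigenvalue A i)))"

definition spectral_embedding ::
    "(nat \<Rightarrow> real^'d) \<Rightarrow> (nat \<Rightarrow> ell2) \<Rightarrow> real^'d \<Rightarrow> ell2" where
  "spectral_embedding u \<phi> x = (\<Sum>i=1..CARD('d). (u i \<bullet> x) *\<^sub>R \<phi> i)"

end

theory Submission
  imports Defs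
begin

text \<open>Since \<open>-1\<close> is not an eigenvalue, it lies in the resolvent set, and \<open>T = (A + 1)\<^sup>-\<^sup>1\<close> is bounded,
  symmetric, positive and injective. The supremum \<open>r\<close> of the form of \<open>T\<close> on the unit sphere of an
  invariant closed subspace belongs to the spectrum of \<open>T\<close>, hence is isolated there, and isolation
  makes it an eigenvalue. Applied to the orthogonal complements of the eigenvectors already found,
  this gives an orthonormal sequence \<open>e\<close> with \<open>A e\<^sub>n = \<lambda>\<^sub>n e\<^sub>n\<close> and \<open>\<lambda>\<^sub>n\<close> increasing. By finite
  multiplicity and isolation \<open>\<lambda>\<^sub>n \<longlonglongrightarrow> \<infinity>\<close>, so \<open>e\<close> is total and \<open>A\<close> and its square root are diagonal.

  In this basis the energy of \<open>\<Phi>\<close> is \<open>\<Sum>\<^sub>n \<lambda>\<^sub>n \<Sum>\<^sub>j \<sigma>\<^sub>j\<^sup>2 w\<^sub>j\<^sub>n\<close> with \<open>w\<^sub>j\<^sub>n = |\<langle>\<Phi> u\<^sub>j, e\<^sub>n\<rangle>|\<^sup>2\<close>, where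
  \<open>\<Sum>\<^sub>n w\<^sub>j\<^sub>n = 1\<close> and \<open>\<Sum>\<^sub>j w\<^sub>j\<^sub>n \<le> 1\<close>. Summation by parts in \<open>j\<close> reduces the bound to the inequality
  \<open>\<Sum>\<^sub>n \<lambda>\<^sub>n \<Sum>\<^bsub>j\<le>k\<^esub> w\<^sub>j\<^sub>n \<ge> \<Sum>\<^bsub>j\<le>k\<^esub> \<lambda>\<^sub>j\<close> of Ky Fan for each \<open>k\<close>. If the singular values are distinct and
  non-zero, a minimizer has equality for every \<open>k\<close>, so that \<open>w\<^sub>j\<^sub>n = 0\<close> unless \<open>\<lambda>\<^sub>n = \<lambda>\<^sub>j\<close>.\<close>

section \<open>Positive symmetric operators\<close>

text \<open>Symmetry and positivity are required on \<open>N\<close> alone: the main instance is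
  \<open>r - T\<close> on the orthogonal complement of eigenvectors already found, where
  \<open>r\<close> bounds the form of \<open>T\<close> only on that complement.\<close>

locale pos_sym_on =
  fixes N :: "'a::real_inner set" and B :: "'a \<Rightarrow> 'a" and K :: real
  assumes subspace: "subspace N"
    and bounded_linear: "bounded_linear B"
    and invariant: "f \<in> N \<Longrightarrow> B f \<in> N"
    and symmetric: "f \<in> N \<Longrightarrow> g \<in> N \<Longrightarrow> B f \<bullet> g = f \<bullet> B g"
    and nonneg: "f \<in> N \<Longrightarrow> 0 \<le> B f \<bullet> f"
    and K_pos: "0 < K"
    and norm_bound: "norm (B f) \<le> K * norm f"
begin

sublocale bounded_linear B by (rule bounded_linear)

text \<open>Positivity at the point reached from \<open>f\<close> by a gradient step of length
  \<open>1/K\<close> gives the bound. It makes a small form value force a small image; a zero of the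
  form lies in the kernel.\<close>

lemma norm_sq_le:
  assumes f: "f \<in> N"
  shows "(norm (B f))\<^sup>2 \<le> K * (B f \<bullet> f)"
proof -
  let ?g = "B f"
  let ?h = "f - (1/K) *\<^sub>R ?g"
  have gN: "?g \<in> N" by (rule invariant[OF f])
  have "?h \<in> N"
    using subspace f gN by (simp add: subspace_diff subspace_scale)
  then have "0 \<le> B ?h \<bullet> ?h" by (rule nonneg)
  also have "B ?h \<bullet> ?h = ?g \<bullet> f - 2 / K * (?g \<bullet> ?g) + (1/K)\<^sup>2 * (B ?g \<bullet> ?g)"
    using symmetric[OF f gN] symmetric[OF gN f]
    by (simp add: diff scaleR inner_diff_left inner_diff_right power2_eq_square inner_commute)
  also have "B ?g \<bullet> ?g \<le> norm (B ?g) * norm ?g" by (rule norm_cauchy_schwarz)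
  also have "\<dots> \<le> K * norm ?g * norm ?g" by (intro mult_right_mono norm_bound) simp
  also have "\<dots> = K * (?g \<bullet> ?g)" by (simp add: dot_square_norm power2_eq_square)
  finally have "0 \<le> ?g \<bullet> f - 2 / K * (?g \<bullet> ?g) + (1/K)\<^sup>2 * (K * (?g \<bullet> ?g))"
    by (simp add: mult_left_mono)
  also have "\<dots> = ?g \<bullet> f - (?g \<bullet> ?g) / K"
    using K_pos by (simp add: power2_eq_square field_simps)
  finally show ?thesis using K_pos by (simp add: dot_square_norm field_simps)
qed

text \<open>If \<open>(0, \<delta>)\<close> misses the approximate spectrum of \<open>B\<close>, then the infimum \<open>m\<close> of the form of
  \<open>C\<^sup>2 = (B - \<delta>/2)\<^sup>2\<close> is at least \<open>(\<delta>/2)\<^sup>2\<close>: otherwise both factors \<open>B - \<delta>/2 \<plusminus> \<surd>m\<close> of \<open>C\<^sup>2 - m\<close>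
  would be bounded below. No functional calculus is needed.\<close>

lemma norm_sq_ge:
  assumes d: "0 < \<delta>"
    and gap: "\<And>c. 0 < c \<Longrightarrow> c < \<delta> \<Longrightarrow> \<exists>k>0. \<forall>f\<in>N. k * norm f \<le> norm (B f - c *\<^sub>R f)"
    and f: "f \<in> N"
  shows "\<delta> * (B f \<bullet> f) \<le> (norm (B f))\<^sup>2"
proof (cases "f = 0")
  case True
  then show ?thesis by (simp add: zero)
next
  case False
  define C where "C h = B h - (\<delta>/2) *\<^sub>R h" for h
  have C: "bounded_linear C"
    unfolding C_def
    by (intro bounded_linear_sub bounded_linear bounded_linear_scaleR_right)
  interpret C: bounded_linear C by (rule C)
  have C_N: "C h \<in> N" if "h \<in> N" for h
    unfolding C_def using subspace that by (simp add: invariant subspace_diff subspace_scale)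
  have C_sym: "C h \<bullet> g = h \<bullet> C g" if "h \<in> N" "g \<in> N" for h g
    unfolding C_def using symmetric[OF that] by (simp add: inner_diff_left inner_diff_right)
  have C_norm: "norm (C h) \<le> (K + \<delta>) * norm h" for h
  proof -
    have "norm (C h) \<le> norm (B h) + norm ((\<delta>/2) *\<^sub>R h)"
      unfolding C_def by (rule norm_triangle_ineq4)
    also have "\<dots> \<le> K * norm h + (\<delta>/2) * norm h" using norm_bound[of h] d by simp
    also have "\<dots> \<le> (K + \<delta>) * norm h" using d by (simp add: field_simps)
    finally show ?thesis .
  qed
  define Q where "Q = (\<lambda>h. (norm (C h))\<^sup>2) ` {h\<in>N. norm h = 1}"
  define m where "m = Inf Q"
  have "(1 / norm f) *\<^sub>R f \<in> {h\<in>N. norm h = 1}"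
    using f False subspace by (simp add: subspace_scale)
  then have Q_ne: "Q \<noteq> {}" unfolding Q_def by blast
  have Q_bdd: "bdd_below Q" unfolding Q_def by (rule bdd_belowI[of _ 0]) auto
  have m0: "0 \<le> m"
    unfolding m_def by (rule cInf_greatest[OF Q_ne]) (auto simp: Q_def)
  have m_le: "m * (norm h)\<^sup>2 \<le> (norm (C h))\<^sup>2" if h: "h \<in> N" for h
  proof (cases "h = 0")
    case False
    have "(1 / norm h) *\<^sub>R h \<in> {h\<in>N. norm h = 1}"
      using h False subspace by (simp add: subspace_scale)
    then have "(norm (C ((1 / norm h) *\<^sub>R h)))\<^sup>2 \<in> Q" unfolding Q_def by blast
    then have "m \<le> (norm (C ((1 / norm h) *\<^sub>R h)))\<^sup>2"
      unfolding m_def by (rule cInf_lower[OF _ Q_bdd])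
    then show ?thesis using False by (simp add: C.scaleR power_divide field_simps)
  qed simp
  define S where "S h = C (C h) - m *\<^sub>R h" for h
  have S: "bounded_linear S"
    unfolding S_def
    by (intro bounded_linear_sub bounded_linear_compose[OF C C] bounded_linear_scaleR_right)
  \<comment> \<open>\<open>S\<close> is positive on \<open>N\<close> because \<open>m\<close> is the
    infimum of the form of the square of \<open>C\<close>, so \<open>norm_sq_le\<close> becomes
    available for \<open>S\<close>.\<close>
  interpret S: pos_sym_on N S "(K + \<delta>)\<^sup>2 + m"
  proof (intro pos_sym_on.intro subspace S)
    show "S h \<in> N" if "h \<in> N" for h
      unfolding S_def using subspace that by (simp add: C_N subspace_diff subspace_scale)
    show "S h \<bullet> g = h \<bullet> S g" if "h \<in> N" "g \<in> N" for h g
      unfolding S_def using that by (simp add: C_sym C_N inner_diff_left inner_diff_right)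
    show "0 \<le> S h \<bullet> h" if "h \<in> N" for h
      unfolding S_def using that m_le[OF that]
      by (simp add: C_sym C_N inner_diff_left dot_square_norm)
    show "0 < (K + \<delta>)\<^sup>2 + m" using K_pos d m0 by (simp add: add_pos_nonneg)
    show "norm (S h) \<le> ((K + \<delta>)\<^sup>2 + m) * norm h" for h
    proof -
      have "norm (S h) \<le> norm (C (C h)) + norm (m *\<^sub>R h)"
        unfolding S_def by (rule norm_triangle_ineq4)
      also have "\<dots> \<le> (K + \<delta>) * ((K + \<delta>) * norm h) + m * norm h"
        using m0 K_pos d by (intro add_mono order_trans[OF C_norm] mult_left_mono C_norm) auto
      finally show ?thesis by (simp add: power2_eq_square algebra_simps)
    qed
  qed
  have "(\<delta>/2)\<^sup>2 \<le> m"
  proof (rule ccontr)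
    assume "\<not> (\<delta>/2)\<^sup>2 \<le> m"
    \<comment> \<open>This puts both \<open>\<delta>/2 - sqrt m\<close> and
      \<open>\<delta>/2 + sqrt m\<close> inside the gap.\<close>
    then have r: "sqrt m < \<delta>/2" using d by (intro real_less_lsqrt) (simp_all add: m0)
    have r0: "0 \<le> sqrt m" using m0 by simp
    have "\<exists>k>0. \<forall>f\<in>N. k * norm f \<le> norm (B f - (\<delta>/2 - sqrt m) *\<^sub>R f)"
      using r r0 by (intro gap) linarith+
    then obtain k1 where k1: "k1 > 0"
      "\<And>h. h \<in> N \<Longrightarrow> k1 * norm h \<le> norm (B h - (\<delta>/2 - sqrt m) *\<^sub>R h)" by blast
    have "\<exists>k>0. \<forall>f\<in>N. k * norm f \<le> norm (B f - (\<delta>/2 + sqrt m) *\<^sub>R f)"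
      using r r0 d by (intro gap) linarith+
    then obtain k2 where k2: "k2 > 0"
      "\<And>h. h \<in> N \<Longrightarrow> k2 * norm h \<le> norm (B h - (\<delta>/2 + sqrt m) *\<^sub>R h)" by blast
    let ?M = "(K + \<delta>)\<^sup>2 + m"
    \<comment> \<open>\<open>S\<close> is the composition of
      \<open>B - (\<delta>/2 - sqrt m)\<close> and \<open>B - (\<delta>/2 + sqrt m)\<close>, so the
      two lower bounds multiply.\<close>
    have S_ge: "k1 * k2 \<le> norm (S h)" if h: "h \<in> N" "norm h = 1" for h
    proof -
      define g where "g = B h - (\<delta>/2 + sqrt m) *\<^sub>R h"
      have g: "g \<in> N"
        unfolding g_def using subspace h by (simp add: invariant subspace_diff subspace_scale)
      have "S h = C (C h) - (sqrt m * sqrt m) *\<^sub>R h"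
        using m0 by (simp add: S_def)
      also have "\<dots> = B g - (\<delta>/2 - sqrt m) *\<^sub>R g"
        unfolding C_def g_def by (simp add: add diff scaleR algebra_simps)
      finally have "k1 * norm g \<le> norm (S h)" using k1(2)[OF g] by simp
      moreover have "k1 * k2 \<le> k1 * norm g"
        using k2(2)[OF h(1)] h(2) k1(1) by (simp add: g_def)
      ultimately show ?thesis by simp
    qed
    \<comment> \<open>The margin is tuned so that a unit vector with value within it of
      \<open>m\<close> violates \<open>S.norm_sq_le\<close>.\<close>
    have pos: "0 < (k1 * k2)\<^sup>2 / ?M" using k1 k2 S.K_pos by simp
    then have "Inf Q < m + (k1 * k2)\<^sup>2 / ?M" unfolding m_def by simp
    then obtain h where h: "h \<in> N" "norm h = 1" "(norm (C h))\<^sup>2 < m + (k1 * k2)\<^sup>2 / ?M"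
      using cInf_lessD[OF Q_ne] unfolding Q_def by blast
    have "(k1 * k2)\<^sup>2 \<le> (norm (S h))\<^sup>2"
      using S_ge[OF h(1,2)] k1 k2 by (intro power_mono) auto
    also have "\<dots> \<le> ?M * (S h \<bullet> h)" by (rule S.norm_sq_le[OF h(1)])
    also have "S h \<bullet> h = (norm (C h))\<^sup>2 - m"
      unfolding S_def using h(1,2) by (simp add: C_sym C_N inner_diff_left dot_square_norm)
    also have "?M * \<dots> < (k1 * k2)\<^sup>2" using h(3) S.K_pos by (simp add: field_simps)
    finally show False by simp
  qed
  then have "(\<delta>/2)\<^sup>2 * (norm f)\<^sup>2 \<le> (norm (C f))\<^sup>2"
    using m_le[OF f] by (meson mult_right_mono order_trans zero_le_power2)
  also have "\<dots> = (norm (B f))\<^sup>2 - \<delta> * (B f \<bullet> f) + (\<delta>/2)\<^sup>2 * (norm f)\<^sup>2"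
    unfolding C_def power2_norm_eq_inner
    by (simp add: inner_diff_left inner_diff_right inner_commute power2_eq_square field_simps)
  finally show ?thesis by simp
qed

end

text \<open>Gradient descent for the quadratic form, whose values decrease geometrically because of the
  Polyak-Lojasiewicz inequality \<open>PL\<close>.\<close>

lemma kernel_nontrivial:
  fixes B :: "'a::{real_inner,banach} \<Rightarrow> 'a"
  assumes "pos_sym_on N B K" and "closed N" and d: "0 < \<delta>" "\<delta> \<le> K"
    and PL: "\<And>f. f \<in> N \<Longrightarrow> \<delta> * (B f \<bullet> f) \<le> (norm (B f))\<^sup>2"
    and small: "\<And>\<epsilon>. 0 < \<epsilon> \<Longrightarrow> \<exists>f\<in>N. norm f = 1 \<and> B f \<bullet> f < \<epsilon>"
  shows "\<exists>f\<in>N. f \<noteq> 0 \<and> B f = 0"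
proof -
  interpret pos_sym_on N B K by fact
  \<comment> \<open>One descent step multiplies the form by at most \<open>s\<^sup>2\<close>, so the
    lengths of the steps are bounded by a multiple of \<open>s ^ n\<close>.\<close>
  define s where "s = sqrt (1 - \<delta> / K)"
  have s: "0 \<le> s" "s < 1" "s\<^sup>2 = 1 - \<delta> / K"
    using d K_pos by (simp_all add: s_def)
  \<comment> \<open>Chosen so that the step lengths are at most
    \<open>((1 - s) / 2) * s ^ n\<close>, with sum 1/2. The limit is then within 1/2 of the unit
    vector \<open>f0\<close> and cannot be zero.\<close>
  define \<epsilon> where "\<epsilon> = K * ((1 - s) / 2)\<^sup>2"
  have "0 < \<epsilon>" using K_pos s by (simp add: \<epsilon>_def)
  then obtain f0 where f0: "f0 \<in> N" "norm f0 = 1" "B f0 \<bullet> f0 < \<epsilon>" using small by blast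
  define F where "F n = ((\<lambda>f. f - (1/K) *\<^sub>R B f) ^^ n) f0" for n
  have F_0: "F 0 = f0" and F_Suc: "F (Suc n) = F n - (1/K) *\<^sub>R B (F n)" for n
    by (simp_all add: F_def)
  have F_N: "F n \<in> N" for n
    by (induction n) (use f0 subspace in \<open>simp_all add: F_0 F_Suc invariant subspace_diff subspace_scale\<close>)
  define q where "q n = B (F n) \<bullet> F n" for n
  have q0: "0 \<le> q n" for n unfolding q_def by (intro nonneg F_N)
  have q_Suc: "q (Suc n) \<le> s\<^sup>2 * q n" for n
  proof -
    let ?f = "F n" and ?g = "B (F n)"
    have gN: "?g \<in> N" by (intro invariant F_N)
    have "q (Suc n) = ?g \<bullet> ?f - 2 / K * (?g \<bullet> ?g) + (1/K)\<^sup>2 * (B ?g \<bullet> ?g)"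
      using symmetric[OF F_N[of n] gN] symmetric[OF gN F_N[of n]]
      by (simp add: q_def F_Suc diff scaleR inner_diff_left inner_diff_right power2_eq_square inner_commute)
    also have "B ?g \<bullet> ?g \<le> norm (B ?g) * norm ?g" by (rule norm_cauchy_schwarz)
    also have "\<dots> \<le> K * norm ?g * norm ?g" by (intro mult_right_mono norm_bound) simp
    also have "\<dots> = K * (?g \<bullet> ?g)" by (simp add: dot_square_norm power2_eq_square)
    finally have "q (Suc n) \<le> ?g \<bullet> ?f - 2 / K * (?g \<bullet> ?g) + (1/K)\<^sup>2 * (K * (?g \<bullet> ?g))"
      by (simp add: mult_left_mono)
    also have "\<dots> = q n - (norm ?g)\<^sup>2 / K"
      using K_pos by (simp add: q_def dot_square_norm power2_eq_square field_simps)
    also have "\<dots> \<le> q n - \<delta> * q n / K"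
      using PL[OF F_N[of n]] K_pos by (simp add: q_def divide_right_mono)
    finally show ?thesis by (simp add: s(3) algebra_simps)
  qed
  have q_le: "q n \<le> (s ^ n)\<^sup>2 * q 0" for n
  proof (induction n)
    case (Suc n)
    have "q (Suc n) \<le> s\<^sup>2 * q n" by (rule q_Suc)
    also have "\<dots> \<le> s\<^sup>2 * ((s ^ n)\<^sup>2 * q 0)" by (intro mult_left_mono Suc) simp
    finally show ?case by (simp add: power_mult_distrib mult.assoc)
  qed simp
  have B_le: "norm (B (F n)) \<le> K * ((1 - s) / 2) * s ^ n" for n
  proof (rule power2_le_imp_le)
    have "(norm (B (F n)))\<^sup>2 \<le> K * q n" unfolding q_def by (intro norm_sq_le F_N)
    also have "\<dots> \<le> K * ((s ^ n)\<^sup>2 * \<epsilon>)"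
      using q_le[of n] f0(3) K_pos q0[of n]
      by (intro mult_left_mono order_trans[OF q_le] mult_left_mono) (auto simp: q_def F_0)
    also have "\<dots> = (K * ((1 - s) / 2) * s ^ n)\<^sup>2" by (simp add: \<epsilon>_def power2_eq_square)
    finally show "(norm (B (F n)))\<^sup>2 \<le> (K * ((1 - s) / 2) * s ^ n)\<^sup>2" .
    show "0 \<le> K * ((1 - s) / 2) * s ^ n" using K_pos s by simp
  qed
  define D where "D n = F (Suc n) - F n" for n
  have D_le: "norm (D n) \<le> ((1 - s) / 2) * s ^ n" for n
    using B_le[of n] K_pos by (simp add: D_def F_Suc field_simps)
  have geo: "summable (\<lambda>n. ((1 - s) / 2) * s ^ n)"
    using s by (intro summable_mult summable_geometric) simp
  have sD: "summable D"
    by (rule summable_comparison_test'[OF geo, of 0]) (use D_le in simp)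
  have "norm (suminf D) \<le> (\<Sum>n. ((1 - s) / 2) * s ^ n)"
    by (rule norm_suminf_le[OF D_le geo])
  also have "\<dots> = 1 / 2" using s by (subst suminf_mult) (simp_all add: suminf_geometric summable_geometric)
  finally have half: "norm (suminf D) \<le> 1 / 2" .
  have "(\<lambda>n. \<Sum>i<n. D i) \<longlonglongrightarrow> suminf D" by (rule summable_LIMSEQ[OF sD])
  then have "(\<lambda>n. f0 + (\<Sum>i<n. D i)) \<longlonglongrightarrow> f0 + suminf D" by (intro tendsto_intros)
  moreover have "f0 + (\<Sum>i<n. D i) = F n" for n
    unfolding D_def by (simp add: sum_lessThan_telescope F_0)
  ultimately have lim: "F \<longlonglongrightarrow> f0 + suminf D" by simp
  have "(\<lambda>n. B (F n)) \<longlonglongrightarrow> B (f0 + suminf D)" by (rule tendsto[OF lim])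
  moreover have "(\<lambda>n. B (F n)) \<longlonglongrightarrow> 0"
  proof (rule Lim_null_comparison)
    show "\<forall>\<^sub>F n in sequentially. norm (B (F n)) \<le> K * ((1 - s) / 2) * s ^ n"
      using B_le by simp
    show "(\<lambda>n. K * ((1 - s) / 2) * s ^ n) \<longlonglongrightarrow> 0"
      using s by (intro tendsto_mult_right_zero LIMSEQ_realpow_zero)
  qed
  ultimately have "B (f0 + suminf D) = 0" by (rule LIMSEQ_unique)
  moreover have "f0 + suminf D \<in> N"
    using \<open>closed N\<close> F_N lim by (rule closed_sequentially)
  moreover have "f0 + suminf D \<noteq> 0"
    using half f0(2) norm_diff_ineq[of f0 "suminf D"] by auto
  ultimately show ?thesis by blast
qed

section \<open>Geometry of the sequence space\<close>

lemma cinner_self_norm: "cinner f f = of_real ((norm f)\<^sup>2)"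
proof -
  have "cinner f f = of_real (Re (cinner f f))"
    by (simp add: cinner_self)
  also have "Re (cinner f f) = (norm f)\<^sup>2"
    by (simp add: inner_ell2_def flip: dot_square_norm)
  finally show ?thesis .
qed

lemma Re_cinner_self [simp]: "Re (cinner f f) = (norm f)\<^sup>2"
  by (simp add: cinner_self_norm flip: of_real_power)

lemma cinner_scaleC_right: "cinner f (c *\<^sub>C g) = cnj c * cinner f g"
  by (subst (1 2) cinner_commute) (simp add: cinner_scaleC_left)

lemma norm_scaleC: "norm (c *\<^sub>C f) = cmod c * norm f"
proof (rule power2_eq_imp_eq)
  have "complex_of_real ((norm (c *\<^sub>C f))\<^sup>2) = cinner (c *\<^sub>C f) (c *\<^sub>C f)"
    by (rule cinner_self_norm[symmetric])
  also have "\<dots> = (c * cnj c) * cinner f f"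
    by (simp add: cinner_scaleC_left cinner_scaleC_right)
  also have "\<dots> = of_real ((cmod c * norm f)\<^sup>2)"
    by (simp add: cinner_self_norm power_mult_distrib flip: complex_norm_square)
  finally have "complex_of_real ((norm (c *\<^sub>C f))\<^sup>2) = of_real ((cmod c * norm f)\<^sup>2)" .
  then show "(norm (c *\<^sub>C f))\<^sup>2 = (cmod c * norm f)\<^sup>2" by (simp only: of_real_eq_iff)
qed simp_all

lemma cinner_add_right: "cinner f (g + h) = cinner f g + cinner f h"
  by (subst (1 2 3) cinner_commute) (simp add: cinner_add_left)

text \<open>Multiplying \<open>f\<close> by a phase makes the complex inner product real and
  non-negative, which reduces the claim to the Cauchy-Schwarz inequality of the real inner
  product.\<close>

lemma cmod_cinner_le: "cmod (cinner f g) \<le> norm f * norm g"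
proof (cases "cinner f g = 0")
  case False
  define c where "c = cnj (cinner f g) / of_real (cmod (cinner f g))"
  have c: "cmod c = 1" using False by (simp add: c_def norm_divide)
  have "cinner (c *\<^sub>C f) g = of_real (cmod (cinner f g))"
    using False by (simp add: c_def cinner_scaleC_left field_simps flip: complex_norm_square)
      (simp add: power2_eq_square)
  then have "cmod (cinner f g) = inner (c *\<^sub>C f) g" by (simp add: inner_ell2_def)
  also have "\<dots> \<le> norm (c *\<^sub>C f) * norm g" by (rule norm_cauchy_schwarz)
  finally show ?thesis by (simp add: norm_scaleC c)
qed simp

global_interpretation cinner: bounded_bilinear cinner
proof
  show "\<exists>K. \<forall>f g. norm (cinner f g) \<le> norm f * norm g * K"
    using cmod_cinner_le by (intro exI[of _ 1]) simp
qed (simp_all add: cinner_add_left cinner_add_right cinner_scaleC_left cinner_scaleC_right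
      scaleR_ell2_def scaleR_conv_of_real)

section \<open>Coordinates and completeness\<close>

lemma norm_sq_ell2: "(norm f)\<^sup>2 = (\<Sum>\<^sub>\<infinity>k. (cmod (seq f k))\<^sup>2)"
  by (metis Re_cinner_self Re_complex_of_real cinner_self)

lemma sum_seq_le_norm_sq: "finite F \<Longrightarrow> (\<Sum>k\<in>F. (cmod (seq f k))\<^sup>2) \<le> (norm f)\<^sup>2"
  unfolding norm_sq_ell2 using seq[of f] by (intro finite_sum_le_infsum) simp_all

lemma cmod_seq_le: "cmod (seq f k) \<le> norm f"
  using sum_seq_le_norm_sq[of "{k}" f] by (simp add: power_mono_iff)

text \<open>The limit is built coordinate by coordinate; bounds on finite partial sums, uniform in
  the finite set, survive the passage to the limit and then control the whole norm.\<close>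

instance ell2 :: banach
proof
  fix X :: "nat \<Rightarrow> ell2"
  assume X: "Cauchy X"
  have "Cauchy (\<lambda>n. seq (X n) k)" for k
  proof (rule CauchyI)
    fix \<epsilon> :: real assume "0 < \<epsilon>"
    then obtain M where "\<And>m n. M \<le> m \<Longrightarrow> M \<le> n \<Longrightarrow> norm (X m - X n) < \<epsilon>"
      using CauchyD[OF X] by blast
    then show "\<exists>M. \<forall>m\<ge>M. \<forall>n\<ge>M. cmod (seq (X m) k - seq (X n) k) < \<epsilon>"
      by (metis cmod_seq_le le_less_trans minus_ell2.rep_eq)
  qed
  then have "\<forall>k. \<exists>l. (\<lambda>n. seq (X n) k) \<longlonglongrightarrow> l" by (auto simp: Cauchy_convergent_iff convergent_def)
  then obtain L where L: "(\<lambda>n. seq (X n) k) \<longlonglongrightarrow> L k" for k by metis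
  \<comment> \<open>Restricting the Cauchy estimate to a finite index set allows the limit in
    \<open>m\<close> to be taken termwise.\<close>
  have fin: "\<exists>M. \<forall>n\<ge>M. \<forall>F. finite F \<longrightarrow> (\<Sum>k\<in>F. (cmod (L k - seq (X n) k))\<^sup>2) \<le> \<epsilon>\<^sup>2"
    if "0 < \<epsilon>" for \<epsilon>
  proof -
    obtain M where M: "\<And>m n. M \<le> m \<Longrightarrow> M \<le> n \<Longrightarrow> norm (X m - X n) < \<epsilon>"
      using CauchyD[OF X \<open>0 < \<epsilon>\<close>] by blast
    have "(\<Sum>k\<in>F. (cmod (L k - seq (X n) k))\<^sup>2) \<le> \<epsilon>\<^sup>2" if "finite F" "M \<le> n" for F n
    proof (rule LIMSEQ_le_const2)
      show "(\<lambda>m. \<Sum>k\<in>F. (cmod (seq (X m) k - seq (X n) k))\<^sup>2)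
          \<longlonglongrightarrow> (\<Sum>k\<in>F. (cmod (L k - seq (X n) k))\<^sup>2)"
        by (intro tendsto_intros L)
      have "(\<Sum>k\<in>F. (cmod (seq (X m) k - seq (X n) k))\<^sup>2) \<le> \<epsilon>\<^sup>2" if "M \<le> m" for m
      proof -
        have "(\<Sum>k\<in>F. (cmod (seq (X m) k - seq (X n) k))\<^sup>2) \<le> (norm (X m - X n))\<^sup>2"
          using sum_seq_le_norm_sq[OF \<open>finite F\<close>, of "X m - X n"] by (simp add: minus_ell2.rep_eq)
        also have "\<dots> \<le> \<epsilon>\<^sup>2" using M[OF that \<open>M \<le> n\<close>] by (intro power_mono) auto
        finally show ?thesis .
      qed
      then show "\<exists>N. \<forall>m\<ge>N. (\<Sum>k\<in>F. (cmod (seq (X m) k - seq (X n) k))\<^sup>2) \<le> \<epsilon>\<^sup>2" by blast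
    qed
    then show ?thesis by blast
  qed
  obtain M where M: "\<And>F. finite F \<Longrightarrow> (\<Sum>k\<in>F. (cmod (L k - seq (X M) k))\<^sup>2) \<le> 1\<^sup>2"
    using fin[of 1] by auto
  \<comment> \<open>\<open>L\<close> is square-summable as the sum of \<open>L - X M\<close> and
    \<open>X M\<close>.\<close>
  have "(\<lambda>k. (cmod (L k - seq (X M) k))\<^sup>2) summable_on UNIV"
    by (rule nonneg_bdd_above_summable_on) (auto intro!: bdd_aboveI2[of _ _ "1\<^sup>2"] M)
  then have "(\<lambda>k. (cmod (L k - seq (X M) k + seq (X M) k))\<^sup>2) summable_on UNIV"
    using seq[of "X M"] by (intro seq_add_summable) simp_all
  then have sL: "seq (Abs_ell2 L) = L" by (simp add: Abs_ell2_inverse)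
  have "X \<longlonglongrightarrow> Abs_ell2 L"
  proof (rule metric_LIMSEQ_I)
    fix \<epsilon> :: real assume "0 < \<epsilon>"
    then obtain M where M: "\<And>n F. M \<le> n \<Longrightarrow> finite F \<Longrightarrow>
        (\<Sum>k\<in>F. (cmod (L k - seq (X n) k))\<^sup>2) \<le> (\<epsilon>/2)\<^sup>2"
      using fin[of "\<epsilon>/2"] by auto
    have "dist (X n) (Abs_ell2 L) < \<epsilon>" if "M \<le> n" for n
    proof -
      have "(norm (Abs_ell2 L - X n))\<^sup>2 \<le> (\<epsilon>/2)\<^sup>2"
        unfolding norm_sq_ell2 using M[OF that] seq[of "Abs_ell2 L - X n"]
        by (intro infsum_le_finite_sums) (simp_all add: minus_ell2.rep_eq sL)
      then have "norm (Abs_ell2 L - X n) \<le> \<epsilon>/2"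
        by (rule power2_le_imp_le) (use \<open>0 < \<epsilon>\<close> in simp)
      then show ?thesis using \<open>0 < \<epsilon>\<close> by (simp add: dist_norm norm_minus_commute)
    qed
    then show "\<exists>M. \<forall>n\<ge>M. dist (X n) (Abs_ell2 L) < \<epsilon>" by blast
  qed
  then show "convergent X" by (rule convergentI)
qed

section \<open>Orthonormal families\<close>

lemma independent_orthonormal:
  assumes on: "\<And>i j. i \<in> I \<Longrightarrow> j \<in> I \<Longrightarrow> cinner (e i) (e j) = (if i = j then 1 else 0)"
  shows "inj_on e I" and "ell2.independent (e ` I)"
proof -
  show inj: "inj_on e I" by (rule inj_onI) (metis on zero_neq_one)
  show "ell2.independent (e ` I)"
    unfolding ell2.independent_explicit_module
  proof (intro allI impI)
    fix T u v assume T: "finite T" "T \<subseteq> e ` I" "(\<Sum>w\<in>T. u w *\<^sub>C w) = 0" "v \<in> T"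
    have "cinner w v = (if w = v then 1 else 0)" if "w \<in> T" for w
      using that T(2,4) on by (smt (verit) imageE subset_iff)
    then have "(\<Sum>w\<in>T. u w * cinner w v) = (\<Sum>w\<in>T. if w = v then u w else 0)"
      by (intro sum.cong) simp_all
    then have "cinner (\<Sum>w\<in>T. u w *\<^sub>C w) v = (\<Sum>w\<in>T. if w = v then u w else 0)"
      by (simp add: cinner.sum_left cinner_scaleC_left)
    then show "u v = 0" using T by (simp add: cinner.zero_left)
  qed
qed

text \<open>The unit sequences are an infinite orthonormal family. This keeps the construction of
  eigenvectors from stopping.\<close>

lemma not_finite_dimensional:
  assumes "finite B"
  shows "ell2.span B \<noteq> UNIV"
proof
  assume span: "ell2.span B = UNIV"
  define e where "e i = Abs_ell2 (\<lambda>k. if k = i then 1 else 0)" for i :: int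
  have "(\<lambda>k. (cmod (if k = i then 1 else 0))\<^sup>2) summable_on UNIV" for i :: int
    by (rule summable_on_cong_neutral[THEN iffD1, OF _ _ _ summable_on_finite[of "{i}" "\<lambda>_. 1"]]) auto
  then have seq_e: "seq (e i) = (\<lambda>k. if k = i then 1 else 0)" for i
    by (simp add: e_def Abs_ell2_inverse)
  have "cinner (e i) (e j) = (if i = j then 1 else 0)" for i j
  proof -
    have "cinner (e i) (e j) = (\<Sum>\<^sub>\<infinity>k. if k = i then if i = j then 1 else 0 else 0)"
      unfolding cinner.rep_eq seq_e by (rule infsum_cong) auto
    also have "\<dots> = (\<Sum>\<^sub>\<infinity>k\<in>{i}. if i = j then 1 else 0)" by (rule infsum_cong_neutral) auto
    finally show ?thesis by simp
  qed
  then have "inj e" "ell2.independent (range e)"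
    using independent_orthonormal[of UNIV e] by auto
  moreover have "finite (range e)"
    using ell2.independent_span_bound[OF assms \<open>ell2.independent (range e)\<close>] span by simp
  ultimately show False using finite_imageD[of e UNIV] infinite_UNIV_int by blast
qed

text \<open>A vector outside the span of the family, minus its projection onto that span, is as
  required.\<close>

lemma exists_orthogonal:
  assumes on: "\<And>i j. i < n \<Longrightarrow> j < n \<Longrightarrow> cinner (e i) (e j) = (if i = j then 1 else 0)"
  shows "\<exists>f. f \<noteq> 0 \<and> (\<forall>i<n::nat. cinner f (e i) = 0)"
proof -
  obtain g where g: "g \<notin> ell2.span (e ` {..<n})"
    using not_finite_dimensional[of "e ` {..<n}"] by auto
  define f where "f = g - (\<Sum>i<n. cinner g (e i) *\<^sub>C e i)"
  have "(\<Sum>i<n. cinner g (e i) *\<^sub>C e i) \<in> ell2.span (e ` {..<n})"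
    by (intro ell2.span_sum ell2.span_scale ell2.span_base) simp
  then have "f \<noteq> 0" using g by (auto simp: f_def)
  moreover have "cinner f (e j) = 0" if "j < n" for j
  proof -
    have "(\<Sum>i<n. cinner g (e i) * cinner (e i) (e j)) = (\<Sum>i<n. if i = j then cinner g (e i) else 0)"
      using that on by (intro sum.cong) auto
    then show ?thesis
      using that by (simp add: f_def cinner.diff_left cinner.sum_left cinner_scaleC_left)
  qed
  ultimately show ?thesis by blast
qed

lemma norm_sum_orthonormal:
  assumes "finite F" and on: "\<And>i j. i \<in> F \<Longrightarrow> j \<in> F \<Longrightarrow> cinner (e i) (e j) = (if i = j then 1 else 0)"
  shows "(norm (\<Sum>i\<in>F. a i *\<^sub>C e i))\<^sup>2 = (\<Sum>i\<in>F. (cmod (a i))\<^sup>2)"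
proof -
  have *: "(\<Sum>i\<in>F. a i * cinner (e i) (e j)) = a j" if "j \<in> F" for j
  proof -
    have "(\<Sum>i\<in>F. a i * cinner (e i) (e j)) = (\<Sum>i\<in>F. if i = j then a i else 0)"
      using on that by (intro sum.cong) auto
    then show ?thesis using that assms(1) by simp
  qed
  have "complex_of_real ((norm (\<Sum>i\<in>F. a i *\<^sub>C e i))\<^sup>2) = (\<Sum>j\<in>F. cnj (a j) * (\<Sum>i\<in>F. a i * cinner (e i) (e j)))"
    unfolding cinner_self_norm[symmetric]
    by (subst cinner.sum_right) (simp add: cinner.sum_left cinner_scaleC_left cinner_scaleC_right)
  also have "\<dots> = (\<Sum>j\<in>F. cnj (a j) * a j)" using * by (intro sum.cong) simp_all
  also have "\<dots> = of_real (\<Sum>j\<in>F. (cmod (a j))\<^sup>2)"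
    by (simp add: complex_norm_square mult.commute del: of_real_power)
  finally show ?thesis by (simp only: of_real_eq_iff)
qed

text \<open>The difference of the two sides is the squared distance of \<open>f\<close> from its
  projection.\<close>

lemma bessel_inequality:
  assumes "finite F" and on: "\<And>i j. i \<in> F \<Longrightarrow> j \<in> F \<Longrightarrow> cinner (e i) (e j) = (if i = j then 1 else 0)"
  shows "(\<Sum>i\<in>F. (cmod (cinner f (e i)))\<^sup>2) \<le> (norm f)\<^sup>2"
proof -
  let ?g = "\<Sum>i\<in>F. cinner f (e i) *\<^sub>C e i"
  have "cinner f ?g = (\<Sum>i\<in>F. of_real ((cmod (cinner f (e i)))\<^sup>2))"
    by (simp add: cinner.sum_right cinner_scaleC_right complex_norm_square mult.commute del: of_real_power)
  then have "f \<bullet> ?g = (\<Sum>i\<in>F. (cmod (cinner f (e i)))\<^sup>2)"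
    by (simp add: inner_ell2_def flip: of_real_sum)
  moreover have "(norm (f - ?g))\<^sup>2 = (norm f)\<^sup>2 - 2 * (f \<bullet> ?g) + (norm ?g)\<^sup>2"
    by (simp add: power2_norm_eq_inner inner_diff_left inner_diff_right inner_commute)
  ultimately have "(norm (f - ?g))\<^sup>2 = (norm f)\<^sup>2 - (\<Sum>i\<in>F. (cmod (cinner f (e i)))\<^sup>2)"
    by (simp add: norm_sum_orthonormal[OF assms])
  then show ?thesis by (metis diff_ge_0_iff_ge zero_le_power2)
qed

locale orthonormal_seq =
  fixes e :: "nat \<Rightarrow> ell2"
  assumes orthonormal: "cinner (e m) (e n) = (if m = n then 1 else 0)"
begin

lemma cinner_sum_scaleC:
  "finite F \<Longrightarrow> cinner (\<Sum>n\<in>F. a n *\<^sub>C e n) (e m) = (if m \<in> F then a m else 0)"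
  by (simp add: cinner.sum_left cinner_scaleC_left orthonormal if_distrib cong: sum.cong if_cong)

lemma norm_sum_scaleC:
  "finite F \<Longrightarrow> (norm (\<Sum>n\<in>F. a n *\<^sub>C e n))\<^sup>2 = (\<Sum>n\<in>F. (cmod (a n))\<^sup>2)"
  by (rule norm_sum_orthonormal) (simp_all add: orthonormal)

text \<open>By Pythagoras the partial sums are Cauchy; completeness supplies the limit, and
  continuity of the inner product reads off its coefficients.\<close>

lemma riesz_fischer:
  assumes "summable (\<lambda>n. (cmod (a n))\<^sup>2)"
  obtains f where "(\<lambda>n. a n *\<^sub>C e n) sums f" "\<And>n. cinner f (e n) = a n"
proof -
  have "summable (\<lambda>n. a n *\<^sub>C e n)"
    unfolding summable_Cauchy
  proof (intro allI impI)
    fix \<epsilon> :: real assume "0 < \<epsilon>"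
    then obtain N where N: "\<And>m n. N \<le> m \<Longrightarrow> norm (\<Sum>i=m..<n. (cmod (a i))\<^sup>2) < \<epsilon>\<^sup>2"
      using assms unfolding summable_Cauchy by (meson zero_less_power)
    have "norm (\<Sum>i=m..<n. a i *\<^sub>C e i) < \<epsilon>" if "N \<le> m" for m n
      using N[OF that, of n] \<open>0 < \<epsilon>\<close>
      by (intro power2_less_imp_less[of _ \<epsilon>]) (simp_all add: norm_sum_scaleC sum_nonneg)
    then show "\<exists>N. \<forall>m\<ge>N. \<forall>n. norm (\<Sum>i=m..<n. a i *\<^sub>C e i) < \<epsilon>" by blast
  qed
  then obtain f where f: "(\<lambda>n. a n *\<^sub>C e n) sums f" by (auto simp: summable_def)
  have "cinner f (e n) = a n" for n
  proof -
    have "(\<lambda>k. cinner (a k *\<^sub>C e k) (e n)) sums cinner f (e n)"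
      by (rule bounded_linear.sums[OF cinner.bounded_linear_left f])
    moreover have "(\<lambda>k. cinner (a k *\<^sub>C e k) (e n)) = (\<lambda>k. if k = n then a k else 0)"
      by (auto simp: cinner_scaleC_left orthonormal)
    ultimately show ?thesis using sums_unique2 sums_single by metis
  qed
  with f show ?thesis by (rule that)
qed

lemma bessel_summable: "summable (\<lambda>n. (cmod (cinner f (e n)))\<^sup>2)"
  by (rule bounded_imp_summable[of _ "(norm f)\<^sup>2"]) (simp_all add: bessel_inequality orthonormal)

end

text \<open>Totality is phrased through orthogonality because the decay of the eigenvalues of
  \<open>T\<close> yields it in this form.\<close>

locale orthonormal_basis = orthonormal_seq +
  assumes total: "(\<And>n. cinner f (e n) = 0) \<Longrightarrow> f = 0"
begin

lemma ell2_eqI: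
  assumes "\<And>n. cinner f (e n) = cinner g (e n)"
  shows "f = g"
  using total[of "f - g"] assms by (simp add: cinner.diff_left)

lemma expansion: "(\<lambda>n. cinner f (e n) *\<^sub>C e n) sums f"
  by (rule riesz_fischer[OF bessel_summable[of f]]) (metis ell2_eqI)

lemma parseval: "(\<lambda>n. cinner f (e n) * cnj (cinner g (e n))) sums cinner f g"
  using bounded_linear.sums[OF cinner.bounded_linear_left expansion[of f], of g]
  by (simp add: cinner_scaleC_left flip: cinner_commute)

lemma parseval_norm: "(\<lambda>n. (cmod (cinner f (e n)))\<^sup>2) sums (norm f)\<^sup>2"
  using bounded_linear.sums[OF bounded_linear_Re parseval[of f f]]
  by (simp flip: complex_norm_square)

end

section \<open>Self-adjoint operators\<close>

text \<open>Shared by \<open>adjoint_op\<close> and \<open>diag_op\<close>, whose values are both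
  chosen by \<open>THE\<close> under an existence test; afterwards only their graphs matter.\<close>

lemma if_ex_The_eq_Some_iff:
  assumes "\<And>x y. P x \<Longrightarrow> P y \<Longrightarrow> x = y"
  shows "(if \<exists>h. P h then Some (THE h. P h) else None) = Some h \<longleftrightarrow> P h"
proof (cases "\<exists>h. P h")
  case True
  then obtain h0 where "P h0" ..
  then have "(THE h. P h) = h0" using assms by blast
  then show ?thesis using \<open>P h0\<close> assms by auto
qed auto

lemma partial_function_eqI:
  assumes "\<And>x y. A x = Some y \<longleftrightarrow> B x = Some y"
  shows "A = B"
proof
  fix x
  show "A x = B x"
  proof (cases "B x")
    case None
    then have "A x \<noteq> Some y" for y using assms[of x y] by simp
    with None show ?thesis by (cases "A x") auto
  next
    case (Some y)
    then show ?thesis using assms[of x y] by simp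
  qed
qed

text \<open>Orthogonality to \<open>h\<close> is a closed condition, so it passes from
  \<open>S\<close> to every vector, including \<open>h\<close> itself.\<close>

lemma dense_orthogonal_imp_zero:
  assumes "closure S = UNIV" "\<And>f. f \<in> S \<Longrightarrow> cinner f h = 0"
  shows "h = 0"
proof -
  have "closed {f. cinner f h = 0}"
    by (intro closed_Collect_eq continuous_intros
        bounded_linear.continuous_on[OF cinner.bounded_linear_left])
  then have "closure S \<subseteq> {f. cinner f h = 0}" using assms(2) by (intro closure_minimal) auto
  then have "cinner h h = 0" using assms(1) by auto
  then show ?thesis by (simp add: cinner_self_norm)
qed

lemma adjoint_op_Some_iff:
  assumes "closure (dom A) = UNIV"
  shows "adjoint_op A g = Some h \<longleftrightarrow> (\<forall>f f'. A f = Some f' \<longrightarrow> cinner f' g = cinner f h)"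
proof -
  let ?P = "\<lambda>h. \<forall>f\<in>dom A. cinner (the (A f)) g = cinner f h"
  have P_iff: "?P h \<longleftrightarrow> (\<forall>f f'. A f = Some f' \<longrightarrow> cinner f' g = cinner f h)" for h by force
  have uniq: "h1 = h2" if "?P h1" "?P h2" for h1 h2
    using dense_orthogonal_imp_zero[OF assms, of "h1 - h2"] that by (simp add: cinner.diff_right)
  have "adjoint_op A g = Some h \<longleftrightarrow> ?P h"
    unfolding adjoint_op_def by (rule if_ex_The_eq_Some_iff) (rule uniq)
  then show ?thesis using P_iff by simp
qed

text \<open>Read from right to left this is a test for membership in the domain; it expresses the
  maximality of self-adjoint operators among symmetric ones.\<close>

lemma self_adjoint_Some_iff:
  assumes "self_adjoint A"
  shows "A g = Some h \<longleftrightarrow> (\<forall>f f'. A f = Some f' \<longrightarrow> cinner f' g = cinner f h)"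
proof -
  have "closure (dom A) = UNIV" and eq: "adjoint_op A = A"
    using assms unfolding self_adjoint_def by blast+
  from adjoint_op_Some_iff[OF this(1), of g h] show ?thesis unfolding eq .
qed

lemma self_adjoint_symmetric:
  assumes "self_adjoint A" "A f = Some f'" "A g = Some g'"
  shows "cinner f' g = cinner f g'"
  using iffD1[OF self_adjoint_Some_iff[OF assms(1)] assms(3)] assms(2) by blast

text \<open>The third assumption puts \<open>A\<close> inside its adjoint, the fourth puts the
  adjoint inside \<open>A\<close>.\<close>

lemma self_adjointI:
  assumes "linear_op A" and dense: "closure (dom A) = UNIV"
    and "\<And>f f' g g'. A f = Some f' \<Longrightarrow> A g = Some g' \<Longrightarrow> cinner f' g = cinner f g'"
    and "\<And>g h. (\<And>f f'. A f = Some f' \<Longrightarrow> cinner f' g = cinner f h) \<Longrightarrow> A g = Some h"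
  shows "self_adjoint A"
proof -
  have "adjoint_op A g = Some h \<longleftrightarrow> A g = Some h" for g h
    unfolding adjoint_op_Some_iff[OF dense]
  proof
    assume "\<forall>f f'. A f = Some f' \<longrightarrow> cinner f' g = cinner f h"
    then show "A g = Some h" by (intro assms(4)) simp
  qed (intro allI impI assms(3))
  then have "adjoint_op A = A" by (rule partial_function_eqI)
  then show ?thesis unfolding self_adjoint_def using assms(1,2) by blast
qed

lemma positive_semidefiniteD:
  assumes "positive_semidefinite A" "A f = Some f'"
  shows "0 \<le> Re (cinner f' f)"
proof -
  have "f \<in> dom A" using assms(2) by (rule domI)
  then have "cinner (the (A f)) f \<in> \<real>\<^sub>\<ge>\<^sub>0"
    using assms(1) unfolding positive_semidefinite_def by (rule bspec[rotated])
  then show ?thesis using assms(2) by (simp add: complex_nonneg_Reals_iff)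
qed

section \<open>Diagonal operators\<close>

context orthonormal_basis
begin

text \<open>Multiplication by \<open>a n\<close> in the basis, with maximal domain: \<open>f\<close>
  belongs to it when the multiplied coefficients are again those of a vector.\<close>

definition diag_op :: "(nat \<Rightarrow> real) \<Rightarrow> (ell2 \<rightharpoonup> ell2)" where
  "diag_op a f =
    (if \<exists>h. \<forall>n. cinner h (e n) = a n * cinner f (e n)
     then Some (THE h. \<forall>n. cinner h (e n) = a n * cinner f (e n)) else None)"

lemma diag_op_Some_iff: "diag_op a f = Some h \<longleftrightarrow> (\<forall>n. cinner h (e n) = a n * cinner f (e n))"
  unfolding diag_op_def by (rule if_ex_The_eq_Some_iff, rule ell2_eqI, simp)

lemma diag_op_basis: "diag_op a (e n) = Some (a n *\<^sub>R e n)"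
  by (simp add: diag_op_Some_iff orthonormal cinner.scaleR_left scaleR_conv_of_real)

text \<open>Truncated expansions show density, Parseval shows symmetry, and testing against the
  basis vectors shows that the adjoint has no larger domain.\<close>

lemma self_adjoint_diag_op: "self_adjoint (diag_op a)"
proof (rule self_adjointI)
  show "linear_op (diag_op a)"
    unfolding linear_op_def diag_op_Some_iff
    by (auto simp: cinner.zero_left cinner_add_left cinner_scaleC_left algebra_simps)
  show "closure (dom (diag_op a)) = UNIV"
  proof (intro set_eqI iffI UNIV_I)
    fix f
    have "diag_op a (\<Sum>n<N. cinner f (e n) *\<^sub>C e n) =
        Some (\<Sum>n<N. (a n * cinner f (e n)) *\<^sub>C e n)" for N
      unfolding diag_op_Some_iff by (simp add: cinner_sum_scaleC)
    then have "(\<Sum>n<N. cinner f (e n) *\<^sub>C e n) \<in> dom (diag_op a)" for N by blast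
    moreover have "(\<lambda>N. \<Sum>n<N. cinner f (e n) *\<^sub>C e n) \<longlonglongrightarrow> f"
      using expansion[of f] by (simp add: sums_def)
    ultimately show "f \<in> closure (dom (diag_op a))"
      unfolding closure_sequential by (intro exI[of _ "\<lambda>N. \<Sum>n<N. cinner f (e n) *\<^sub>C e n"] conjI allI)
  qed
  show "cinner f' g = cinner f g'" if "diag_op a f = Some f'" "diag_op a g = Some g'" for f f' g g'
  proof -
    have "(\<lambda>n. cinner f' (e n) * cnj (cinner g (e n))) = (\<lambda>n. cinner f (e n) * cnj (cinner g' (e n)))"
      using that unfolding diag_op_Some_iff by auto
    then show ?thesis using parseval[of f' g] parseval[of f g'] sums_unique2 by metis
  qed
  show "diag_op a g = Some h" if "\<And>f f'. diag_op a f = Some f' \<Longrightarrow> cinner f' g = cinner f h" for g h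
    unfolding diag_op_Some_iff
  proof
    fix n
    have "of_real (a n) * cinner (e n) g = cinner (e n) h"
      using that[OF diag_op_basis[of a n]] by (simp add: cinner.scaleR_left scaleR_conv_of_real)
    then have "cnj (of_real (a n) * cinner (e n) g) = cnj (cinner (e n) h)" by simp
    then show "cinner h (e n) = a n * cinner g (e n)" by (simp flip: cinner_commute)
  qed
qed

lemma positive_semidefinite_diag_op:
  assumes "\<And>n. 0 \<le> a n"
  shows "positive_semidefinite (diag_op a)"
  unfolding positive_semidefinite_def
proof
  fix f assume "f \<in> dom (diag_op a)"
  then obtain h where h: "diag_op a f = Some h" by blast
  have "(\<lambda>n. cinner h (e n) * cnj (cinner f (e n))) sums cinner h f" by (rule parseval)
  moreover have "cinner h (e n) * cnj (cinner f (e n)) = of_real (a n * (cmod (cinner f (e n)))\<^sup>2)" for n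
    using h unfolding diag_op_Some_iff by (simp add: complex_norm_square mult.assoc del: of_real_power)
  ultimately have s: "(\<lambda>n. complex_of_real (a n * (cmod (cinner f (e n)))\<^sup>2)) sums cinner h f" by simp
  have "0 \<le> Re (cinner h f)"
    by (rule sums_le[OF _ sums_zero bounded_linear.sums[OF bounded_linear_Re s]]) (simp add: assms)
  moreover have "Im (cinner h f) = 0"
    using bounded_linear.sums[OF bounded_linear_Im s] by (simp add: sums_iff)
  ultimately show "cinner (the (diag_op a f)) f \<in> \<real>\<^sub>\<ge>\<^sub>0"
    using h by (simp add: complex_nonneg_Reals_iff)
qed

text \<open>Pairing with basis vectors shows that \<open>B\<close> is a restriction of the diagonal
  operator. As a self-adjoint operator has no proper symmetric extension, the two coincide.\<close>

lemma self_adjoint_eq_diag_op: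
  assumes B: "self_adjoint B" and Be: "\<And>n. B (e n) = Some (b n *\<^sub>R e n)"
  shows "B = diag_op b"
proof -
  have sub: "diag_op b f = Some h" if "B f = Some h" for f h
    unfolding diag_op_Some_iff
  proof
    fix n
    have "cinner h (e n) = cinner f (b n *\<^sub>R e n)"
      by (rule self_adjoint_symmetric[OF B that Be])
    then show "cinner h (e n) = b n * cinner f (e n)"
      by (simp add: cinner.scaleR_right scaleR_conv_of_real)
  qed
  have "B f = Some h" if "diag_op b f = Some h" for f h
  proof (rule iffD2[OF self_adjoint_Some_iff[OF B]], intro allI impI)
    fix g g' assume "B g = Some g'"
    then show "cinner g' f = cinner g h"
      by (rule self_adjoint_symmetric[OF self_adjoint_diag_op sub that])
  qed
  with sub have "B f = Some h \<longleftrightarrow> diag_op b f = Some h" for f h by blast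
  then show ?thesis by (rule partial_function_eqI)
qed

text \<open>The domains are the point. If \<open>c\<close> is a coefficient of \<open>f\<close>, the
  squared modulus of \<open>b n * c\<close> is the product of the moduli of \<open>c\<close> and
  \<open>(b n)\<^sup>2 * c\<close>, so the domain for the squares lies in the domain for
  \<open>b\<close>.\<close>

lemma diag_op_comp: "diag_op b \<circ>\<^sub>m diag_op b = diag_op (\<lambda>n. (b n)\<^sup>2)"
proof -
  have "(diag_op b \<circ>\<^sub>m diag_op b) f = Some h \<longleftrightarrow> diag_op (\<lambda>n. (b n)\<^sup>2) f = Some h" for f h
  proof
    assume "(diag_op b \<circ>\<^sub>m diag_op b) f = Some h"
    then obtain g where "diag_op b f = Some g" "diag_op b g = Some h"
      by (auto simp: map_comp_Some_iff)
    then show "diag_op (\<lambda>n. (b n)\<^sup>2) f = Some h"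
      unfolding diag_op_Some_iff by (simp add: power2_eq_square)
  next
    assume h: "diag_op (\<lambda>n. (b n)\<^sup>2) f = Some h"
    have "summable (\<lambda>n. (cmod (b n * cinner f (e n)))\<^sup>2)"
    proof (rule summable_comparison_test')
      show "summable (\<lambda>n. (cmod (cinner f (e n)))\<^sup>2 + (cmod (cinner h (e n)))\<^sup>2)"
        by (intro summable_add bessel_summable)
      fix n
      have "(cmod (b n * cinner f (e n)))\<^sup>2 = cmod (cinner f (e n)) * cmod (cinner h (e n))"
        using h unfolding diag_op_Some_iff by (simp add: norm_mult norm_power power_mult_distrib power2_eq_square)
      moreover have "0 \<le> (cmod (cinner f (e n)) - cmod (cinner h (e n)))\<^sup>2"
        "0 \<le> cmod (cinner f (e n)) * cmod (cinner h (e n))" by simp_all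
      ultimately show "norm ((cmod (b n * cinner f (e n)))\<^sup>2)
          \<le> (cmod (cinner f (e n)))\<^sup>2 + (cmod (cinner h (e n)))\<^sup>2"
        unfolding power2_diff real_norm_def abs_power2 by linarith
    qed
    then obtain g where g: "\<And>n. cinner g (e n) = b n * cinner f (e n)" by (rule riesz_fischer) blast
    have "diag_op b f = Some g" unfolding diag_op_Some_iff using g by blast
    moreover have "diag_op b g = Some h"
      using h unfolding diag_op_Some_iff by (simp add: g power2_eq_square)
    ultimately show "(diag_op b \<circ>\<^sub>m diag_op b) f = Some h"
      unfolding map_comp_Some_iff by blast
  qed
  then show ?thesis by (rule partial_function_eqI)
qed

text \<open>For uniqueness let \<open>B\<close> be a root and \<open>s = sqrt (a n)\<close>. The
  vector \<open>B (e n) - s e n\<close> is mapped by \<open>B\<close> to its multiple by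
  \<open>-s\<close>, which positivity allows only for the zero vector if \<open>s > 0\<close>. Hence
  \<open>B\<close> is diagonal in the same basis.\<close>

lemma sqrt_op_diag_op:
  assumes a: "\<And>n. 0 \<le> a n"
  shows "sqrt_op (diag_op a) = diag_op (\<lambda>n. sqrt (a n))"
  unfolding sqrt_op_def
proof (rule the_equality, intro conjI)
  show "self_adjoint (diag_op (\<lambda>n. sqrt (a n)))" by (rule self_adjoint_diag_op)
  show "positive_semidefinite (diag_op (\<lambda>n. sqrt (a n)))"
    using a by (simp add: positive_semidefinite_diag_op)
  show "diag_op (\<lambda>n. sqrt (a n)) \<circ>\<^sub>m diag_op (\<lambda>n. sqrt (a n)) = diag_op a"
    using a by (simp add: diag_op_comp)
next
  fix B assume B: "self_adjoint B \<and> positive_semidefinite B \<and> B \<circ>\<^sub>m B = diag_op a"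
  have lin: "linear_op B" using B by (simp add: self_adjoint_def)
  have "B (e n) = Some (sqrt (a n) *\<^sub>R e n)" for n
  proof -
    have "(B \<circ>\<^sub>m B) (e n) = Some (a n *\<^sub>R e n)" using B diag_op_basis by simp
    then obtain f where f: "B (e n) = Some f" "B f = Some (a n *\<^sub>R e n)"
      by (auto simp: map_comp_Some_iff)
    define s where "s = sqrt (a n)"
    have s: "0 \<le> s" "a n = s * s" using a[of n] by (simp_all add: s_def)
    define g where "g = f - s *\<^sub>R e n"
    have "B ((- of_real s) *\<^sub>C e n) = Some ((- of_real s) *\<^sub>C f)"
      using lin f(1) unfolding linear_op_def by blast
    then have "B (f + (- of_real s) *\<^sub>C e n) = Some (a n *\<^sub>R e n + (- of_real s) *\<^sub>C f)"
      using lin f(2) unfolding linear_op_def by blast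
    then have Bg: "B g = Some (- s *\<^sub>R g)"
      by (simp add: g_def s(2) scaleR_ell2_def algebra_simps ell2.scale_left_distrib
          ell2.scale_right_diff_distrib flip: of_real_mult)
    have "g = 0"
    proof (cases "s = 0")
      \<comment> \<open>Positivity gives nothing for \<open>s = 0\<close>, but then symmetry shows
        that the squared norm of \<open>f\<close> is the pairing of \<open>e n\<close> with
        zero.\<close>
      case True
      have "cinner f f = cinner (e n) (a n *\<^sub>R e n)"
        using B by (intro self_adjoint_symmetric[OF _ f]) simp
      then show ?thesis
        using True s by (simp add: g_def cinner.zero_right cinner_self_norm)
    next
      case False
      have "0 \<le> Re (cinner (- s *\<^sub>R g) g)" using B Bg by (blast intro: positive_semidefiniteD)
      then have "s * (norm g)\<^sup>2 \<le> 0"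
        by (simp add: cinner.scaleR_left cinner.minus_left)
      then show ?thesis using s False by (simp add: mult_le_0_iff)
    qed
    then show ?thesis using f(1) by (simp add: g_def s_def)
  qed
  then show "B = diag_op (\<lambda>n. sqrt (a n))" using B by (intro self_adjoint_eq_diag_op) auto
qed

text \<open>Parseval for the image under the square root gives one direction; in the other,
  Riesz-Fischer places \<open>f\<close> in the domain of the root. An infinite value shows as the
  absence of such an \<open>r\<close>.\<close>

lemma quadratic_form_diag_op:
  assumes a: "\<And>n. 0 \<le> a n" and r: "0 \<le> r"
  shows "quadratic_form (diag_op a) f = ennreal r \<longleftrightarrow>
    (\<lambda>n. a n * (cmod (cinner f (e n)))\<^sup>2) sums r"
proof -
  have *: "(\<lambda>n. a n * (cmod (cinner f (e n)))\<^sup>2) sums (norm h)\<^sup>2"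
    if "diag_op (\<lambda>n. sqrt (a n)) f = Some h" for h
  proof -
    have "(cmod (cinner h (e n)))\<^sup>2 = a n * (cmod (cinner f (e n)))\<^sup>2" for n
      using that a[of n] unfolding diag_op_Some_iff by (simp add: norm_mult power_mult_distrib)
    then show ?thesis using parseval_norm[of h] by simp
  qed
  show ?thesis
  proof
    assume "quadratic_form (diag_op a) f = ennreal r"
    then obtain h where "diag_op (\<lambda>n. sqrt (a n)) f = Some h" "(norm h)\<^sup>2 = r"
      using r by (auto simp: quadratic_form_def sqrt_op_diag_op[OF a] split: option.splits)
    then show "(\<lambda>n. a n * (cmod (cinner f (e n)))\<^sup>2) sums r" using *[of h] by simp
  next
    assume s: "(\<lambda>n. a n * (cmod (cinner f (e n)))\<^sup>2) sums r"
    have "(\<lambda>n. (cmod (of_real (sqrt (a n)) * cinner f (e n)))\<^sup>2) = (\<lambda>n. a n * (cmod (cinner f (e n)))\<^sup>2)"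
      using a by (simp add: norm_mult power_mult_distrib)
    then have "summable (\<lambda>n. (cmod (of_real (sqrt (a n)) * cinner f (e n)))\<^sup>2)"
      using s by (simp add: sums_iff)
    then obtain h where "\<And>n. cinner h (e n) = of_real (sqrt (a n)) * cinner f (e n)"
      by (rule riesz_fischer) blast
    then have h: "diag_op (\<lambda>n. sqrt (a n)) f = Some h" by (simp add: diag_op_Some_iff)
    have "(norm h)\<^sup>2 = r" by (rule sums_unique2[OF *[OF h] s])
    then show "quadratic_form (diag_op a) f = ennreal r"
      by (simp add: quadratic_form_def sqrt_op_diag_op[OF a] h)
  qed
qed

end

section \<open>Diagonalization of operators with purely discrete spectrum\<close>

lemma minus_one_in_resolvent_set:
  assumes "positive_semidefinite A" "purely_discrete_spectrum A"
  shows "-1 \<in> resolvent_set A"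
proof (rule ccontr)
  assume "-1 \<notin> resolvent_set A"
  then have "is_eigenvalue A (-1)"
    using assms(2) by (auto simp: purely_discrete_spectrum_def spectrum_def)
  then obtain f where f: "A f = Some ((-1) *\<^sub>C f)" "f \<noteq> 0"
    by (auto simp: is_eigenvalue_def eigenspace_def)
  have "0 \<le> Re (cinner ((-1) *\<^sub>C f) f)" by (rule positive_semidefiniteD[OF assms(1) f(1)])
  then show False using f(2) by (simp add: cinner.minus_left)
qed

text \<open>The resolvent sends \<open>(w - z) f\<close> back to \<open>f\<close>. Since
  \<open>K\<close> does not depend on \<open>w\<close>, eigenvalues neither lie in the resolvent set
  nor accumulate at a point of it.\<close>

lemma eigenvector_resolvent_bound:
  assumes "z \<in> resolvent_set A"
  shows "\<exists>K>0. \<forall>f w. A f = Some (w *\<^sub>C f) \<longrightarrow> norm f \<le> cmod (w - z) * K * norm f"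
proof -
  obtain R where R: "bounded_linear R" "\<And>f h. A f = Some h \<Longrightarrow> R (h - z *\<^sub>C f) = f"
    using assms by (force simp: resolvent_set_def)
  obtain K where K: "0 < K" "\<And>f. norm (R f) \<le> norm f * K"
    using bounded_linear.pos_bounded[OF R(1)] by blast
  have "norm f \<le> cmod (w - z) * K * norm f" if "A f = Some (w *\<^sub>C f)" for f w
  proof -
    have "R ((w - z) *\<^sub>C f) = f" using R(2)[OF that] by (simp add: ell2.scale_left_diff_distrib)
    then show ?thesis using K(2)[of "(w - z) *\<^sub>C f"] by (simp add: norm_scaleC mult_ac)
  qed
  with K(1) show ?thesis by blast
qed

lemma eigenvalue_in_spectrum:
  assumes "is_eigenvalue A z"
  shows "z \<in> spectrum A"
proof (rule ccontr)
  assume "z \<notin> spectrum A"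
  then obtain K where "\<And>f w. A f = Some (w *\<^sub>C f) \<Longrightarrow> norm f \<le> cmod (w - z) * K * norm f"
    using eigenvector_resolvent_bound[of z A] unfolding spectrum_def by blast
  then show False using assms by (force simp: is_eigenvalue_def eigenspace_def)
qed

text \<open>\<open>A_T\<close> encodes that \<open>A + 1\<close> after \<open>T\<close> is the
  identity. The search for eigenvectors is carried out for the bounded operator
  \<open>T\<close>.\<close>

locale shifted_inverse =
  fixes A :: "ell2 \<rightharpoonup> ell2" and T :: "ell2 \<Rightarrow> ell2"
  assumes self_adjoint: "self_adjoint A"
    and positive_semidefinite: "positive_semidefinite A"
    and purely_discrete: "purely_discrete_spectrum A"
    and bounded_linear: "bounded_linear T"
    and A_T: "A (T f) = Some (f - T f)"
begin

sublocale T: bounded_linear T by (rule bounded_linear)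

lemma T_symmetric: "cinner (T f) g = cinner f (T g)"
  using self_adjoint_symmetric[OF self_adjoint A_T A_T, of f g]
  by (simp add: cinner.diff_left cinner.diff_right)

text \<open>Positivity of \<open>A\<close> is evaluated at \<open>T f\<close>. The squared norm
  makes the form strictly positive once \<open>T\<close> is known to be injective.\<close>

lemma T_positive: "(norm (T f))\<^sup>2 \<le> T f \<bullet> f"
  using positive_semidefiniteD[OF positive_semidefinite A_T[of f]]
  by (simp add: cinner.diff_left inner_ell2_def T_symmetric[of f f])

lemma T_eq_0_iff: "T f = 0 \<longleftrightarrow> f = 0"
proof
  assume "T f = 0"
  moreover have "A 0 = Some 0" using self_adjoint by (simp add: self_adjoint_def linear_op_def)
  ultimately show "f = 0" using A_T[of f] by simp
qed (simp add: T.zero)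

text \<open>Applying \<open>A - z\<close> with \<open>z = 1 / \<rho> - 1\<close> to
  \<open>T f\<close> gives a multiple of \<open>T f - \<rho> f\<close>. The resolvent therefore
  bounds \<open>T f\<close>, and with it \<open>f\<close>, by that difference.\<close>

lemma bounded_below:
  assumes z: "of_real (1 / \<rho> - 1) \<in> resolvent_set A" and "\<rho> \<noteq> 0"
  shows "\<exists>k>0. \<forall>f. k * norm f \<le> norm (T f - \<rho> *\<^sub>R f)"
proof -
  obtain R where R: "bounded_linear R"
    "\<And>f h. A f = Some h \<Longrightarrow> R (h - of_real (1 / \<rho> - 1) *\<^sub>C f) = f"
    using z by (force simp: resolvent_set_def)
  obtain K where K: "0 < K" "\<And>f. norm (R f) \<le> norm f * K"
    using bounded_linear.pos_bounded[OF R(1)] by blast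
  have bnd: "norm f \<le> (K / \<bar>\<rho>\<bar> + 1) / \<bar>\<rho>\<bar> * norm (T f - \<rho> *\<^sub>R f)" for f
  proof -
    let ?y = "T f - \<rho> *\<^sub>R f"
    have "(f - T f) - of_real (1 / \<rho> - 1) *\<^sub>C T f = (- 1 / \<rho>) *\<^sub>R ?y"
      unfolding scaleR_ell2_def[symmetric]
      using \<open>\<rho> \<noteq> 0\<close> by (simp add: scaleR_diff_left scaleR_diff_right)
    then have "T f = R ((- 1 / \<rho>) *\<^sub>R ?y)" using R(2)[OF A_T[of f]] by simp
    then have T: "norm (T f) \<le> norm ?y / \<bar>\<rho>\<bar> * K"
      using K(2)[of "(- 1 / \<rho>) *\<^sub>R ?y"] by simp
    have "\<bar>\<rho>\<bar> * norm f = norm (T f - ?y)" by simp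
    also have "\<dots> \<le> norm (T f) + norm ?y" by (rule norm_triangle_ineq4)
    also have "\<dots> \<le> (K / \<bar>\<rho>\<bar> + 1) * norm ?y" using T by (simp add: algebra_simps)
    finally have "norm f \<le> ((K / \<bar>\<rho>\<bar> + 1) * norm ?y) / \<bar>\<rho>\<bar>"
      using \<open>\<rho> \<noteq> 0\<close> by (subst pos_le_divide_eq) (simp_all add: mult.commute)
    then show ?thesis by (simp only: times_divide_eq_left)
  qed
  define C where "C = (K / \<bar>\<rho>\<bar> + 1) / \<bar>\<rho>\<bar>"
  have "0 < C" using K \<open>\<rho> \<noteq> 0\<close> by (simp add: C_def add_pos_pos)
  moreover have "norm f \<le> C * norm (T f - \<rho> *\<^sub>R f)" for f
    unfolding C_def by (rule bnd)
  ultimately show ?thesis by (intro exI[of _ "1 / C"]) (simp add: field_simps)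
qed

text \<open>Continuity and injectivity of the map from \<open>c < \<rho>\<close> to
  \<open>1 / (\<rho> - c) - 1\<close> transport isolation in the spectrum of \<open>A\<close> to a
  gap just below \<open>\<rho>\<close>.\<close>

lemma resolvent_gap:
  assumes "0 < \<rho>" and z: "of_real (1 / \<rho> - 1) \<in> spectrum A"
  shows "\<exists>\<delta>>0. \<forall>c. 0 < c \<and> c < \<delta> \<longrightarrow> of_real (1 / (\<rho> - c) - 1) \<in> resolvent_set A"
proof -
  let ?z = "\<lambda>c. complex_of_real (1 / (\<rho> - c) - 1)"
  have "?z 0 isolated_in spectrum A"
    using purely_discrete z by (simp add: purely_discrete_spectrum_def)
  then obtain \<epsilon> where \<epsilon>: "\<epsilon> > 0" "\<And>y. y \<in> spectrum A \<Longrightarrow> dist (?z 0) y < \<epsilon> \<Longrightarrow> y = ?z 0"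
    unfolding isolated_in_dist_Ex_iff by blast
  have "isCont ?z 0" using \<open>0 < \<rho>\<close> by (intro continuous_intros) auto
  then have "\<forall>\<^sub>F c in at_right 0. dist (?z c) (?z 0) < \<epsilon>"
    using \<epsilon>(1) by (intro tendstoD) (auto simp: isCont_def intro: tendsto_within_subset)
  moreover have "\<forall>\<^sub>F c in at_right 0. c < \<rho>"
    using \<open>0 < \<rho>\<close> eventually_at_right[of 0 \<rho>] by auto
  ultimately have "\<forall>\<^sub>F c in at_right 0. dist (?z c) (?z 0) < \<epsilon> \<and> c < \<rho>"
    by (rule eventually_conj)
  then obtain \<delta> where \<delta>: "\<delta> > 0" "\<And>c. 0 < c \<Longrightarrow> c < \<delta> \<Longrightarrow> dist (?z c) (?z 0) < \<epsilon> \<and> c < \<rho>"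
    unfolding eventually_at_right_field by auto
  have "?z c \<in> resolvent_set A" if "0 < c" "c < \<delta>" for c
  proof (rule ccontr)
    assume "?z c \<notin> resolvent_set A"
    then have "?z c = ?z 0"
      using \<epsilon>(2)[of "?z c"] \<delta>(2)[OF that] by (simp add: spectrum_def dist_commute)
    then have "1 / (\<rho> - c) - 1 = 1 / (\<rho> - 0) - 1" by (simp only: of_real_eq_iff)
    then show False using that \<delta>(2)[OF that] \<open>0 < \<rho>\<close> by (simp add: field_simps)
  qed
  then show ?thesis using \<delta>(1) by blast
qed

text \<open>With \<open>r\<close> the supremum of the form on the unit sphere,
  \<open>B = r - T\<close> is positive with infimum zero. Isolation of the spectral value gives a
  gap, \<open>norm_sq_ge\<close> turns the gap into the inequality needed for gradient descent, and
  \<open>kernel_nontrivial\<close> yields the eigenvector.\<close>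

lemma top_eigenvector:
  assumes N: "subspace N" "closed N" and inv: "\<And>f. f \<in> N \<Longrightarrow> T f \<in> N"
    and ne: "\<exists>f\<in>N. f \<noteq> 0"
  shows "\<exists>f\<in>N. norm f = 1 \<and> (\<exists>r>0. T f = r *\<^sub>R f \<and> (\<forall>g\<in>N. T g \<bullet> g \<le> r * (norm g)\<^sup>2))"
proof -
  obtain K where K: "0 < K" "\<And>f. norm (T f) \<le> norm f * K"
    using T.pos_bounded by blast
  define Q where "Q = (\<lambda>f. T f \<bullet> f) ` {f\<in>N. norm f = 1}"
  define r where "r = Sup Q"
  have normalize: "(1 / norm f) *\<^sub>R f \<in> {f\<in>N. norm f = 1}" if "f \<in> N" "f \<noteq> 0" for f
    using that N(1) by (simp add: subspace_scale)
  have "T f \<bullet> f \<le> K" if "norm f = 1" for f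
    using norm_cauchy_schwarz[of "T f" f] K(2)[of f] that by simp
  then have Q_bdd: "bdd_above Q" unfolding Q_def by (auto intro!: bdd_aboveI2[of _ _ K])
  obtain f1 where f1: "f1 \<in> N" "norm f1 = 1" using ne normalize by blast
  \<comment> \<open>Injectivity of \<open>T\<close> makes \<open>r\<close> positive, so that
    \<open>1 / r - 1\<close> is meaningful.\<close>
  have "0 < (norm (T f1))\<^sup>2" using f1 T_eq_0_iff[of f1] by auto
  also have "\<dots> \<le> T f1 \<bullet> f1" by (rule T_positive)
  also have "\<dots> \<le> r" unfolding r_def Q_def[symmetric] using f1 Q_bdd
    by (intro cSup_upper) (auto simp: Q_def)
  finally have r: "0 < r" .
  have le: "T g \<bullet> g \<le> r * (norm g)\<^sup>2" if "g \<in> N" for g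
  proof (cases "g = 0")
    case False
    have "T ((1 / norm g) *\<^sub>R g) \<bullet> ((1 / norm g) *\<^sub>R g) \<in> Q"
      unfolding Q_def by (rule imageI) (rule normalize[OF that False])
    then have "T ((1 / norm g) *\<^sub>R g) \<bullet> ((1 / norm g) *\<^sub>R g) \<le> r"
      unfolding r_def by (rule cSup_upper[OF _ Q_bdd])
    then show ?thesis using False by (simp add: T.scaleR power2_eq_square field_simps)
  qed (simp add: T.zero)
  define B where "B f = r *\<^sub>R f - T f" for f
  have B_norm: "norm (B f) \<le> (r + K) * norm f" for f
    using norm_triangle_ineq4[of "r *\<^sub>R f" "T f"] K(2)[of f] r by (simp add: B_def algebra_simps)
  have "bounded_linear B"
    unfolding B_def by (intro bounded_linear_sub bounded_linear bounded_linear_scaleR_right)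
  then interpret B: pos_sym_on N B "r + K"
  proof (intro pos_sym_on.intro N)
    show "B f \<in> N" if "f \<in> N" for f
      using that N(1) by (simp add: B_def inv subspace_diff subspace_scale)
    show "B f \<bullet> g = f \<bullet> B g" for f g
      by (simp add: B_def inner_diff_left inner_diff_right) (simp add: inner_ell2_def T_symmetric)
    show "0 \<le> B f \<bullet> f" if "f \<in> N" for f
      using le[OF that] by (simp add: B_def inner_diff_left dot_square_norm)
  qed (use r K B_norm in auto)
  have small: "\<exists>f\<in>N. norm f = 1 \<and> B f \<bullet> f < \<epsilon>" if "0 < \<epsilon>" for \<epsilon>
  proof -
    have "Q \<noteq> {}" using f1 by (auto simp: Q_def)
    moreover have "r - \<epsilon> < Sup Q" using that by (simp add: r_def)
    ultimately obtain f where "f \<in> N" "norm f = 1" "r - \<epsilon> < T f \<bullet> f"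
      using less_cSupD[of Q "r - \<epsilon>"] by (auto simp: Q_def)
    then show ?thesis by (intro bexI[of _ f]) (auto simp: B_def inner_diff_left dot_square_norm)
  qed
  \<comment> \<open>Otherwise \<open>B\<close> would be bounded below, while by
    \<open>norm_sq_le\<close> it sends nearly maximizing unit vectors to short ones.\<close>
  have "of_real (1 / r - 1) \<in> spectrum A"
  proof (rule ccontr)
    assume "of_real (1 / r - 1) \<notin> spectrum A"
    then obtain k where k: "0 < k" "\<And>f. k * norm f \<le> norm (T f - r *\<^sub>R f)"
      using bounded_below[of r] r by (auto simp: spectrum_def)
    then obtain f where f: "f \<in> N" "norm f = 1" "B f \<bullet> f < k\<^sup>2 / (r + K)"
      using small[of "k\<^sup>2 / (r + K)"] B.K_pos by auto
    have "k\<^sup>2 \<le> (norm (B f))\<^sup>2"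
      using k(1) k(2)[of f] f(2) by (intro power_mono) (auto simp: B_def norm_minus_commute)
    also have "\<dots> \<le> (r + K) * (B f \<bullet> f)" by (rule B.norm_sq_le[OF f(1)])
    also have "\<dots> < k\<^sup>2" using f(3) B.K_pos by (simp add: field_simps)
    finally show False by simp
  qed
  then obtain \<delta>0 where \<delta>0: "\<delta>0 > 0"
    "\<And>c. 0 < c \<Longrightarrow> c < \<delta>0 \<Longrightarrow> of_real (1 / (r - c) - 1) \<in> resolvent_set A"
    using resolvent_gap[OF r] by blast
  \<comment> \<open>The minimum with \<open>r\<close> keeps \<open>r - c\<close> non-zero and
    secures \<open>\<delta> \<le> r + K\<close>.\<close>
  define \<delta> where "\<delta> = min \<delta>0 r"
  have \<delta>: "0 < \<delta>" "\<delta> \<le> r + K" using \<delta>0 r K by (auto simp: \<delta>_def)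
  have "\<delta> * (B f \<bullet> f) \<le> (norm (B f))\<^sup>2" if "f \<in> N" for f
  proof (rule B.norm_sq_ge[OF \<delta>(1) _ that])
    fix c assume c: "0 < c" "c < \<delta>"
    then have "of_real (1 / (r - c) - 1) \<in> resolvent_set A" "r - c \<noteq> 0"
      using \<delta>0(2)[of c] by (auto simp: \<delta>_def)
    then obtain k where k: "0 < k" "\<And>f. k * norm f \<le> norm (T f - (r - c) *\<^sub>R f)"
      using bounded_below by blast
    have "norm (B f - c *\<^sub>R f) = norm (T f - (r - c) *\<^sub>R f)" for f
      unfolding B_def by (subst norm_minus_commute) (simp add: algebra_simps)
    then show "\<exists>k>0. \<forall>f\<in>N. k * norm f \<le> norm (B f - c *\<^sub>R f)" using k by auto
  qed
  then obtain f where f: "f \<in> N" "f \<noteq> 0" "B f = 0"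
    using kernel_nontrivial[OF B.pos_sym_on_axioms N(2) \<delta> _ small] by blast
  let ?f = "(1 / norm f) *\<^sub>R f"
  have "?f \<in> N" "norm ?f = 1" using normalize[OF f(1,2)] by auto
  moreover have "T f = r *\<^sub>R f" using f(3) by (simp add: B_def)
  then have "T ?f = r *\<^sub>R ?f" by (simp add: T.scaleR)
  ultimately show ?thesis using r le by blast
qed

text \<open>Maximizing the form of \<open>T\<close> successively on the orthogonal complements of the eigenvectors
  found so far yields the eigenvalues of \<open>A\<close> in increasing order.\<close>

lemma greedy_eigenvectors:
  obtains e :: "nat \<Rightarrow> ell2" and r :: "nat \<Rightarrow> real"
  where "orthonormal_seq e" "\<And>n. 0 < r n" "\<And>n. T (e n) = r n *\<^sub>R e n"
    "\<And>n g. (\<And>i. i < n \<Longrightarrow> cinner g (e i) = 0) \<Longrightarrow> T g \<bullet> g \<le> r n * (norm g)\<^sup>2"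
proof -
  \<comment> \<open>Says that \<open>v\<close> is an admissible choice at stage \<open>n\<close>. It
    looks at \<open>\<phi>\<close> only below \<open>n\<close>, as well-ordered choice
    demands.\<close>
  define P where "P \<phi> n v \<longleftrightarrow> norm v = 1 \<and> (\<forall>i<n. cinner v (\<phi> i) = 0) \<and>
    (\<exists>r>0. T v = r *\<^sub>R v \<and> (\<forall>g. (\<forall>i<n. cinner g (\<phi> i) = 0) \<longrightarrow> T g \<bullet> g \<le> r * (norm g)\<^sup>2))"
    for \<phi> :: "nat \<Rightarrow> ell2" and n :: nat and v
  \<comment> \<open>Stated for initial segments, since the induction step needs it before the whole
    sequence exists.\<close>
  have on: "cinner (\<phi> i) (\<phi> j) = (if i = j then 1 else 0)"
    if "\<And>m. m < n \<Longrightarrow> P \<phi> m (\<phi> m)" "i < n" "j < n" for \<phi> n i j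
  proof -
    have lt: "cinner (\<phi> j) (\<phi> i) = 0" if "i < j" "j < n" for i j
      using \<open>\<And>m. m < n \<Longrightarrow> P \<phi> m (\<phi> m)\<close> that by (auto simp: P_def)
    moreover have "cinner (\<phi> i) (\<phi> i) = 1" using that by (simp add: P_def cinner_self_norm)
    moreover have "cinner (\<phi> i) (\<phi> j) = cnj (cinner (\<phi> j) (\<phi> i))" by (rule cinner_commute)
    ultimately show ?thesis using that(2,3) by (cases i j rule: linorder_cases) auto
  qed
  have "\<exists>e. \<forall>n. P e n (e n)"
  proof (rule dependent_wellorder_choice)
    show "P \<phi> n v = P \<psi> n v" if "\<And>m. m < n \<Longrightarrow> \<phi> m = \<psi> m" for \<phi> \<psi> n v
      using that by (simp add: P_def)
  next
    fix \<phi> n assume IH: "\<And>m. m < n \<Longrightarrow> P \<phi> m (\<phi> m)"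
    define N where "N = {g. \<forall>i<n. cinner g (\<phi> i) = 0}"
    have "subspace N"
      by (auto simp: N_def subspace_def cinner.zero_left cinner.add_left cinner.scaleR_left)
    moreover have "closed N"
      unfolding N_def by (intro closed_Collect_all closed_Collect_imp closed_Collect_eq continuous_intros
          open_Collect_const bounded_linear.continuous_on[OF cinner.bounded_linear_left])
    moreover have "T g \<in> N" if "g \<in> N" for g
    proof -
      have "cinner (T g) (\<phi> i) = 0" if i: "i < n" for i
      proof -
        obtain s where "T (\<phi> i) = s *\<^sub>R \<phi> i" using IH[OF i] by (auto simp: P_def)
        then show ?thesis
          using \<open>g \<in> N\<close> i by (simp add: T_symmetric cinner.scaleR_right N_def)
      qed
      then show ?thesis by (simp add: N_def)
    qed
    moreover have "\<exists>f\<in>N. f \<noteq> 0"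
      using exists_orthogonal[of n \<phi>] on[OF IH] by (auto simp: N_def)
    ultimately obtain f where "f \<in> N" "norm f = 1"
      "\<exists>r>0. T f = r *\<^sub>R f \<and> (\<forall>g\<in>N. T g \<bullet> g \<le> r * (norm g)\<^sup>2)"
      using top_eigenvector by blast
    then show "\<exists>v. P \<phi> n v" unfolding P_def N_def by blast
  qed
  then obtain e where e: "\<And>n. P e n (e n)" by blast
  then have "\<forall>n. \<exists>r>0. T (e n) = r *\<^sub>R e n \<and>
      (\<forall>g. (\<forall>i<n. cinner g (e i) = 0) \<longrightarrow> T g \<bullet> g \<le> r * (norm g)\<^sup>2)"
    by (simp add: P_def)
  then obtain r where r: "\<And>n. r n > 0 \<and> T (e n) = r n *\<^sub>R e n \<and>
      (\<forall>g. (\<forall>i<n. cinner g (e i) = 0) \<longrightarrow> T g \<bullet> g \<le> r n * (norm g)\<^sup>2)"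
    by metis
  have "orthonormal_seq e"
  proof
    show "cinner (e i) (e j) = (if i = j then 1 else 0)" for i j
      using on[of "Suc (max i j)" e i j] e by simp
  qed
  with r show ?thesis by (intro that[of e r]) auto
qed

end

lemma exists_shifted_inverse:
  assumes "self_adjoint A" "positive_semidefinite A" "purely_discrete_spectrum A"
  obtains T where "shifted_inverse A T"
proof -
  obtain T where T: "bounded_linear T" "\<And>g. T g \<in> dom A"
    "\<And>g. the (A (T g)) - (-1) *\<^sub>C T g = g"
    using minus_one_in_resolvent_set[OF assms(2,3)] by (auto simp: resolvent_set_def)
  have "shifted_inverse A T"
  proof (intro shifted_inverse.intro assms T(1))
    show "A (T f) = Some (f - T f)" for f
    proof -
      obtain h where h: "A (T f) = Some h" using T(2)[of f] by blast
      then have "h + T f = f" using T(3)[of f] by (simp add: ell2.scale_minus_left)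
      then show ?thesis using h by (metis add_diff_cancel_right')
    qed
  qed
  then show ?thesis by (rule that)
qed

text \<open>A bounded increasing sequence would converge to a spectral value, isolation would make
  it eventually constant, and a finite-dimensional eigenspace would contain infinitely many
  orthonormal vectors.\<close>

lemma eigenvalues_tendsto_at_top:
  assumes pds: "purely_discrete_spectrum A" and "orthonormal_seq e"
    and A_e: "\<And>n. A (e n) = Some (lam n *\<^sub>R e n)" and mono: "incseq lam"
  shows "filterlim lam at_top sequentially"
proof -
  interpret orthonormal_seq e by fact
  have e_norm: "norm (e n) = 1" for n
    using orthonormal[of n n] by (simp add: cinner_self_norm power2_eq_1_iff flip: of_real_power)
      (smt (verit) norm_ge_zero)
  have A_e': "A (e n) = Some (of_real (lam n) *\<^sub>C e n)" for n
    using A_e[of n] by (simp add: scaleR_ell2_def)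
  have spec: "of_real (lam n) \<in> spectrum A" for n
    using A_e'[of n] e_norm[of n]
    by (intro eigenvalue_in_spectrum) (auto simp: is_eigenvalue_def eigenspace_def)
  show ?thesis
  proof (rule ccontr)
    assume "\<not> filterlim lam at_top sequentially"
    then obtain C where "\<And>n. lam n \<le> C"
      using mono unfolding filterlim_at_top_gt[of _ _ 0] eventually_sequentially incseq_def
      by (meson linear order_trans)
    then obtain L where L: "lam \<longlonglongrightarrow> L" using incseq_convergent[OF mono] by blast
    have "complex_of_real L \<in> spectrum A"
    proof (rule ccontr)
      assume "complex_of_real L \<notin> spectrum A"
      then obtain K where K: "0 < K" "\<And>f w. A f = Some (w *\<^sub>C f) \<Longrightarrow> norm f \<le> cmod (w - of_real L) * K * norm f"
        using eigenvector_resolvent_bound[of "of_real L" A] unfolding spectrum_def by blast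
      have "1 \<le> \<bar>lam n - L\<bar> * K" for n
        using K(2)[OF A_e'[of n]] by (simp add: e_norm flip: of_real_diff)
      moreover have "(\<lambda>n. \<bar>lam n - L\<bar> * K) \<longlonglongrightarrow> \<bar>L - L\<bar> * K" by (intro tendsto_intros L)
      ultimately have "1 \<le> \<bar>L - L\<bar> * K" by (intro LIMSEQ_le_const) auto
      then show False by simp
    qed
    then have iso: "complex_of_real L isolated_in spectrum A"
      and "\<exists>B. finite B \<and> eigenspace A (of_real L) \<subseteq> ell2.span B"
      using pds by (auto simp: purely_discrete_spectrum_def)
    then obtain B where B: "finite B" "eigenspace A (of_real L) \<subseteq> ell2.span B" by blast
    obtain \<epsilon> where \<epsilon>: "\<epsilon> > 0" "\<And>y. y \<in> spectrum A \<Longrightarrow> dist (complex_of_real L) y < \<epsilon> \<Longrightarrow> y = of_real L"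
      using iso unfolding isolated_in_dist_Ex_iff by blast
    obtain M where M: "\<And>n. M \<le> n \<Longrightarrow> dist (lam n) L < \<epsilon>"
      using metric_LIMSEQ_D[OF L \<epsilon>(1)] by blast
    have "lam n = L" if "M \<le> n" for n
      using \<epsilon>(2)[OF spec[of n]] M[OF that] by (simp add: dist_norm norm_minus_commute flip: of_real_diff)
    then have "e ` {M..} \<subseteq> ell2.span B"
      using B(2) A_e' by (force simp: eigenspace_def)
    moreover have "ell2.independent (e ` {M..})" "inj_on e {M..}"
      using independent_orthonormal[of "{M..}" e] orthonormal by auto
    ultimately have "finite {M..}"
      using ell2.independent_span_bound[OF B(1)] finite_imageD by blast
    then show False using infinite_Ici by blast
  qed
qed

theorem exists_eigenbasis:
  assumes "self_adjoint A" "positive_semidefinite A" "purely_discrete_spectrum A"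
  obtains e :: "nat \<Rightarrow> ell2" and lam :: "nat \<Rightarrow> real"
  where "orthonormal_basis e" "\<And>n. A (e n) = Some (lam n *\<^sub>R e n)"
    "\<And>n. 0 \<le> lam n" "incseq lam" "filterlim lam at_top sequentially"
proof -
  obtain T where "shifted_inverse A T" using exists_shifted_inverse[OF assms] .
  then interpret shifted_inverse A T .
  obtain e r where e: "orthonormal_seq e" and r: "\<And>n. 0 < r n"
    and T_e: "\<And>n. T (e n) = r n *\<^sub>R e n"
    and top: "\<And>n g. (\<And>i. i < n \<Longrightarrow> cinner g (e i) = 0) \<Longrightarrow> T g \<bullet> g \<le> r n * (norm g)\<^sup>2"
    by (rule greedy_eigenvectors) blast
  interpret orthonormal_seq e by (rule e)
  \<comment> \<open>Solves \<open>r n = 1 / (1 + lam n)\<close>, as \<open>T\<close> inverts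
    \<open>A + 1\<close>.\<close>
  define lam where "lam n = 1 / r n - 1" for n
  have A_e: "A (e n) = Some (lam n *\<^sub>R e n)" for n
    using A_T[of "(1 / r n) *\<^sub>R e n"] r[of n] by (simp add: T.scaleR T_e lam_def scaleR_diff_left)
  have "0 \<le> lam n" for n
    using positive_semidefiniteD[OF positive_semidefinite A_e[of n]]
    by (simp add: cinner.scaleR_left orthonormal)
  have "r (Suc n) \<le> r n" for n
  proof -
    have "norm (e (Suc n)) \<noteq> 0" using orthonormal[of "Suc n" "Suc n"] by (auto simp: cinner.zero_left)
    moreover have "T (e (Suc n)) \<bullet> e (Suc n) \<le> r n * (norm (e (Suc n)))\<^sup>2"
      by (intro top) (simp add: orthonormal)
    ultimately show ?thesis by (simp add: T_e dot_square_norm)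
  qed
  then have "incseq lam"
    unfolding lam_def using r by (intro incseq_SucI) (simp add: frac_le)
  moreover from this have lim: "filterlim lam at_top sequentially"
    using eigenvalues_tendsto_at_top[OF assms(3) e A_e] by blast
  moreover have "orthonormal_basis e"
  proof
    \<comment> \<open>Such an \<open>f\<close> is a competitor at every stage, so its form is at
      most \<open>r n\<close> times its squared norm for all \<open>n\<close>, and
      \<open>r n\<close> tends to zero.\<close>
    fix f assume f: "\<And>n. cinner f (e n) = 0"
    have r_eq: "r = (\<lambda>n. inverse (1 + lam n))" using r by (auto simp: lam_def field_simps)
    have "filterlim (\<lambda>n. 1 + lam n) at_top sequentially"
      by (rule filterlim_tendsto_add_at_top[OF tendsto_const lim])
    then have "r \<longlonglongrightarrow> 0"
      unfolding r_eq by (intro tendsto_inverse_0_at_top)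
    then have "(\<lambda>n. r n * (norm f)\<^sup>2) \<longlonglongrightarrow> 0 * (norm f)\<^sup>2" by (intro tendsto_intros)
    then have "T f \<bullet> f \<le> 0 * (norm f)\<^sup>2"
      using top f by (intro LIMSEQ_le_const) auto
    then have "(norm (T f))\<^sup>2 \<le> 0" using T_positive[of f] by linarith
    then show "f = 0" using T_eq_0_iff by simp
  qed
  ultimately show ?thesis using A_e \<open>\<And>n. 0 \<le> lam n\<close> by (intro that[of e lam])
qed

section \<open>Counting eigenvalues\<close>

text \<open>Turns sums of multiplicities over distinct eigenvalues into counts of indices, for
  \<open>A\<close> as well as for \<open>X X^T\<close>.\<close>

lemma card_eq_sum_fibres:
  assumes "finite S"
  shows "(\<Sum>y\<in>g ` S. card {x\<in>S. g x = y}) = card S"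
  unfolding card_eq_sum by (rule sum.image_gen[OF assms, symmetric])

locale eigenbasis = orthonormal_basis +
  fixes A :: "ell2 \<rightharpoonup> ell2" and lam :: "nat \<Rightarrow> real"
  assumes A_eq: "A = diag_op lam"
    and lam_nonneg: "0 \<le> lam n"
    and lam_mono: "incseq lam"
    and lam_lim: "filterlim lam at_top sequentially"
begin

lemma eigenspace_iff:
  "f \<in> eigenspace A (of_real s) \<longleftrightarrow> (\<forall>n. lam n \<noteq> s \<longrightarrow> cinner f (e n) = 0)"
proof -
  have "f \<in> eigenspace A (of_real s) \<longleftrightarrow> (\<forall>n. (s - lam n) * cinner f (e n) = 0)"
    by (simp add: eigenspace_def A_eq diag_op_Some_iff cinner_scaleC_left algebra_simps)
  also have "\<dots> \<longleftrightarrow> (\<forall>n. lam n \<noteq> s \<longrightarrow> cinner f (e n) = 0)"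
    by (auto simp flip: of_real_diff)
  finally show ?thesis .
qed

lemma finite_lam_le: "finite {n. lam n \<le> t}"
proof -
  have "\<forall>\<^sub>F n in sequentially. t < lam n"
    using lam_lim by (simp add: filterlim_at_top_dense)
  then obtain N where "\<And>n. N \<le> n \<Longrightarrow> t < lam n" by (auto simp: eventually_sequentially)
  then have "{n. lam n \<le> t} \<subseteq> {..<N}" by (auto simp: not_le[symmetric])
  then show ?thesis by (rule finite_subset) simp
qed

lemma finite_lam_eq: "finite {n. lam n = s}"
  by (rule finite_subset[OF _ finite_lam_le[of s]]) auto

lemma eigenspace_eq_span: "eigenspace A (of_real s) = ell2.span (e ` {n. lam n = s})"
proof
  show "eigenspace A (of_real s) \<subseteq> ell2.span (e ` {n. lam n = s})"
  proof
    fix f assume f: "f \<in> eigenspace A (of_real s)"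
    define g where "g = (\<Sum>n\<in>{n. lam n = s}. cinner f (e n) *\<^sub>C e n)"
    have "g \<in> ell2.span (e ` {n. lam n = s})"
      unfolding g_def by (intro ell2.span_sum ell2.span_scale ell2.span_base imageI)
    moreover have "cinner f (e n) = cinner g (e n)" for n
      using f by (simp add: g_def cinner_sum_scaleC finite_lam_eq eigenspace_iff)
    then have "f = g" by (rule ell2_eqI)
    ultimately show "f \<in> ell2.span (e ` {n. lam n = s})" by (simp only:)
  qed
  have "ell2.subspace (eigenspace A (of_real s))"
    by (auto simp: ell2.subspace_def eigenspace_iff cinner.zero_left cinner.add_left cinner_scaleC_left)
  then show "ell2.span (e ` {n. lam n = s}) \<subseteq> eigenspace A (of_real s)"
    by (intro ell2.span_minimal) (auto simp: eigenspace_iff orthonormal)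
qed

lemma dim_eigenspace: "ell2.dim (eigenspace A (of_real s)) = card {n. lam n = s}"
  unfolding eigenspace_eq_span
  using independent_orthonormal[of "{n. lam n = s}" e] orthonormal
  by (simp add: ell2.dim_eq_card_independent card_image)

lemma is_eigenvalue_iff: "is_eigenvalue A (of_real s) \<longleftrightarrow> s \<in> range lam"
proof
  assume "is_eigenvalue A (of_real s)"
  then obtain f where f: "f \<in> eigenspace A (of_real s)" "f \<noteq> 0"
    by (auto simp: is_eigenvalue_def)
  show "s \<in> range lam"
  proof (rule ccontr)
    assume "s \<notin> range lam"
    then have "cinner f (e n) = 0" for n using f(1) by (auto simp: eigenspace_iff)
    then show False using total f(2) by blast
  qed
next
  assume "s \<in> range lam"
  then obtain n where n: "s = lam n" by blast
  then have "e n \<in> eigenspace A (of_real s)" by (auto simp: eigenspace_iff orthonormal)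
  moreover have "e n \<noteq> 0" using orthonormal[of n n] by (auto simp: cinner.zero_left)
  ultimately show "is_eigenvalue A (of_real s)" by (auto simp: is_eigenvalue_def)
qed

lemma num_eigenvalues_le_eq: "num_eigenvalues_le A t = card {n. lam n \<le> t}"
proof -
  have "{s. is_eigenvalue A (of_real s) \<and> s \<le> t} = lam ` {n. lam n \<le> t}"
    by (auto simp: is_eigenvalue_iff)
  moreover have "{n. lam n = s} = {n \<in> {n. lam n \<le> t}. lam n = s}" if "s \<in> lam ` {n. lam n \<le> t}" for s
    using that by auto
  ultimately show ?thesis
    unfolding num_eigenvalues_le_def dim_eigenspace
    using card_eq_sum_fibres[OF finite_lam_le, where g = lam] by simp
qed

text \<open>The definition counts from 1 and \<open>lam\<close> from 0. The indices up to
  \<open>i\<close> all meet the threshold \<open>lam i\<close>, and a smaller threshold admits only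
  indices below \<open>i\<close>.\<close>

lemma lowest_eigenvalue_eq: "lowest_eigenvalue A (Suc i) = lam i"
  unfolding lowest_eigenvalue_def num_eigenvalues_le_eq
proof (rule Least_equality)
  have "{..i} \<subseteq> {n. lam n \<le> lam i}" using lam_mono by (auto simp: incseq_def)
  then show "Suc i \<le> card {n. lam n \<le> lam i}"
    using card_mono[OF finite_lam_le, of "{..i}" "lam i"] by simp
  show "lam i \<le> t" if "Suc i \<le> card {n. lam n \<le> t}" for t
  proof (rule ccontr)
    assume "\<not> lam i \<le> t"
    then have "t < lam n" if "i \<le> n" for n
      using incseqD[OF lam_mono that] by simp
    then have "{n. lam n \<le> t} \<subseteq> {..<i}" by (force simp flip: not_less)
    then have "card {n. lam n \<le> t} \<le> card {..<i}" by (intro card_mono) auto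
    then show False using that by simp
  qed
qed

text \<open>A finite total makes every single form finite; conversely, non-negativity makes every
  single series converge by comparison with the total one. In both cases the finite sum and the
  series may be exchanged.\<close>

lemma sum_quadratic_form_eq:
  fixes f :: "'i \<Rightarrow> ell2"
  assumes "finite I" "0 \<le> E"
  shows "(\<Sum>i\<in>I. quadratic_form A (f i)) = ennreal E \<longleftrightarrow>
    (\<lambda>n. lam n * (\<Sum>i\<in>I. (cmod (cinner (f i) (e n)))\<^sup>2)) sums E"
proof -
  let ?t = "\<lambda>i n. lam n * (cmod (cinner (f i) (e n)))\<^sup>2"
  have total: "(\<Sum>i\<in>I. quadratic_form A (f i)) = ennreal (\<Sum>i\<in>I. q i)"
    "(\<lambda>n. lam n * (\<Sum>i\<in>I. (cmod (cinner (f i) (e n)))\<^sup>2)) sums (\<Sum>i\<in>I. q i)"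
    if q: "\<And>i. i \<in> I \<Longrightarrow> 0 \<le> q i" "\<And>i. i \<in> I \<Longrightarrow> ?t i sums q i" for q
  proof -
    have "quadratic_form A (f i) = ennreal (q i)" if "i \<in> I" for i
      unfolding A_eq using q that lam_nonneg by (subst quadratic_form_diag_op) auto
    then show "(\<Sum>i\<in>I. quadratic_form A (f i)) = ennreal (\<Sum>i\<in>I. q i)"
      using q(1) by (simp add: sum_ennreal)
    show "(\<lambda>n. lam n * (\<Sum>i\<in>I. (cmod (cinner (f i) (e n)))\<^sup>2)) sums (\<Sum>i\<in>I. q i)"
      using sums_sum[of I ?t q] q(2) by (simp add: sum_distrib_left)
  qed
  show ?thesis
  proof
    assume L: "(\<Sum>i\<in>I. quadratic_form A (f i)) = ennreal E"
    have "\<exists>q\<ge>0. ?t i sums q" if "i \<in> I" for i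
    proof -
      have "quadratic_form A (f i) \<le> (\<Sum>i\<in>I. quadratic_form A (f i))"
        using \<open>finite I\<close> that by (intro member_le_sum) auto
      then have "quadratic_form A (f i) < top"
        unfolding L by (rule le_less_trans) (rule ennreal_less_top)
      then obtain q where q: "0 \<le> q" "quadratic_form A (f i) = ennreal q"
        by (cases "quadratic_form A (f i)") auto
      then have "?t i sums q"
        unfolding A_eq by (subst (asm) quadratic_form_diag_op) (auto simp: lam_nonneg)
      with q(1) show ?thesis by blast
    qed
    then obtain q where q: "\<And>i. i \<in> I \<Longrightarrow> 0 \<le> q i" "\<And>i. i \<in> I \<Longrightarrow> ?t i sums q i" by metis
    then have "(\<Sum>i\<in>I. q i) = E"
      using total(1)[of q] L \<open>0 \<le> E\<close> by (simp add: sum_nonneg)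
    then show "(\<lambda>n. lam n * (\<Sum>i\<in>I. (cmod (cinner (f i) (e n)))\<^sup>2)) sums E"
      using total(2)[of q] q by simp
  next
    assume R: "(\<lambda>n. lam n * (\<Sum>i\<in>I. (cmod (cinner (f i) (e n)))\<^sup>2)) sums E"
    have "summable (?t i)" if "i \<in> I" for i
    proof (rule summable_comparison_test')
      show "summable (\<lambda>n. lam n * (\<Sum>i\<in>I. (cmod (cinner (f i) (e n)))\<^sup>2))"
        using R by (simp add: sums_iff)
      show "norm (?t i n) \<le> lam n * (\<Sum>i\<in>I. (cmod (cinner (f i) (e n)))\<^sup>2)" for n
        using lam_nonneg[of n] \<open>finite I\<close> that
        by (simp add: abs_mult) (intro mult_left_mono member_le_sum, auto)
    qed
    then have q: "?t i sums (suminf (?t i))" "0 \<le> suminf (?t i)" if "i \<in> I" for i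
      using that lam_nonneg by (auto simp: summable_sums intro!: suminf_nonneg)
    have "(\<Sum>i\<in>I. suminf (?t i)) = E"
      using total(2)[of "\<lambda>i. suminf (?t i)"] q R sums_unique2 by blast
    then show "(\<Sum>i\<in>I. quadratic_form A (f i)) = ennreal E"
      using total(1)[of "\<lambda>i. suminf (?t i)"] q by simp
  qed
qed

end

section \<open>Singular values\<close>

text \<open>Compactness supplies a maximizer of the form on the unit sphere of \<open>N\<close>.
  There the form of \<open>r - T\<close> vanishes, and \<open>norm_sq_le\<close> turns this into the
  eigenvector equation.\<close>

lemma top_eigenvector_euclidean:
  fixes T :: "'a::euclidean_space \<Rightarrow> 'a"
  assumes T: "linear T" and N: "subspace N" and inv: "\<And>f. f \<in> N \<Longrightarrow> T f \<in> N"
    and sym: "\<And>f g. T f \<bullet> g = f \<bullet> T g" and ne: "\<exists>f\<in>N. f \<noteq> 0"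
  shows "\<exists>f\<in>N. norm f = 1 \<and> (\<exists>r. T f = r *\<^sub>R f \<and> (\<forall>g\<in>N. T g \<bullet> g \<le> r * (norm g)\<^sup>2))"
proof -
  have blT: "bounded_linear T" using T by (simp add: linear_conv_bounded_linear)
  interpret T: bounded_linear T by (rule blT)
  obtain K where K: "0 < K" "\<And>f. norm (T f) \<le> norm f * K" using T.pos_bounded by blast
  have normalize: "(1 / norm f) *\<^sub>R f \<in> sphere 0 1 \<inter> N" if "f \<in> N" "f \<noteq> 0" for f
    using that N by (simp add: subspace_scale)
  have "compact (sphere 0 1 \<inter> N)" by (intro compact_Int_closed closed_subspace N compact_sphere)
  moreover have "sphere 0 1 \<inter> N \<noteq> {}" using ne normalize by blast
  moreover have "continuous_on (sphere 0 1 \<inter> N) (\<lambda>f. T f \<bullet> f)"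
    by (intro continuous_intros T.continuous_on)
  ultimately obtain f where f: "f \<in> sphere 0 1 \<inter> N"
    and max: "\<And>g. g \<in> sphere 0 1 \<inter> N \<Longrightarrow> T g \<bullet> g \<le> T f \<bullet> f"
    using continuous_attains_sup[of "sphere 0 1 \<inter> N" "\<lambda>f. T f \<bullet> f"] by blast
  define r where "r = T f \<bullet> f"
  have le: "T g \<bullet> g \<le> r * (norm g)\<^sup>2" if "g \<in> N" for g
  proof (cases "g = 0")
    case False
    then show ?thesis
      using max[OF normalize[OF that False]] by (simp add: r_def T.scaleR power2_eq_square field_simps)
  qed (simp add: T.zero)
  define B where "B f = r *\<^sub>R f - T f" for f
  have B_norm: "norm (B f) \<le> (\<bar>r\<bar> + K) * norm f" for f
    using norm_triangle_ineq4[of "r *\<^sub>R f" "T f"] K(2)[of f] by (simp add: B_def algebra_simps)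
  have "bounded_linear B"
    unfolding B_def by (intro bounded_linear_sub blT bounded_linear_scaleR_right)
  then interpret B: pos_sym_on N B "\<bar>r\<bar> + K"
  proof (intro pos_sym_on.intro N)
    show "B f \<in> N" if "f \<in> N" for f
      using that N by (simp add: B_def inv subspace_diff subspace_scale)
    show "B f \<bullet> g = f \<bullet> B g" for f g
      by (simp add: B_def inner_diff_left inner_diff_right sym)
    show "0 \<le> B f \<bullet> f" if "f \<in> N" for f
      using le[OF that] by (simp add: B_def inner_diff_left dot_square_norm)
  qed (use K B_norm in auto)
  have "B f \<bullet> f = 0" using f by (simp add: B_def r_def inner_diff_left dot_square_norm)
  then have "B f = 0" using B.norm_sq_le[of f] f by simp
  then have "T f = r *\<^sub>R f" by (simp add: B_def)
  then show ?thesis using f le by auto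
qed

text \<open>The greedy scheme again; the successive maxima come out in decreasing order.\<close>

lemma symmetric_eigenbasis:
  fixes T :: "'a::euclidean_space \<Rightarrow> 'a"
  assumes T: "linear T" and sym: "\<And>f g. T f \<bullet> g = f \<bullet> T g"
  obtains v :: "nat \<Rightarrow> 'a" and s :: "nat \<Rightarrow> real"
  where "\<And>i j. i < DIM('a) \<Longrightarrow> j < DIM('a) \<Longrightarrow> v i \<bullet> v j = (if i = j then 1 else 0)"
    "\<And>i. i < DIM('a) \<Longrightarrow> T (v i) = s i *\<^sub>R v i"
    "\<And>i j. i \<le> j \<Longrightarrow> j < DIM('a) \<Longrightarrow> s j \<le> s i"
proof -
  \<comment> \<open>From stage \<open>DIM('a)\<close> on, \<open>P\<close> holds vacuously, so that
    the choice can run over all natural numbers.\<close>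
  define P where "P \<phi> n w \<longleftrightarrow> (n < DIM('a) \<longrightarrow> norm w = 1 \<and> (\<forall>i<n. w \<bullet> \<phi> i = 0) \<and>
    (\<exists>r. T w = r *\<^sub>R w \<and> (\<forall>g. (\<forall>i<n. g \<bullet> \<phi> i = 0) \<longrightarrow> T g \<bullet> g \<le> r * (norm g)\<^sup>2)))"
    for \<phi> :: "nat \<Rightarrow> 'a" and n :: nat and w
  have "\<exists>v. \<forall>n. P v n (v n)"
  proof (rule dependent_wellorder_choice)
    show "P \<phi> n w = P \<psi> n w" if "\<And>m. m < n \<Longrightarrow> \<phi> m = \<psi> m" for \<phi> \<psi> n w
      using that by (simp add: P_def)
  next
    fix \<phi> n assume IH: "\<And>m. m < n \<Longrightarrow> P \<phi> m (\<phi> m)"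
    show "\<exists>w. P \<phi> n w"
    proof (cases "n < DIM('a)")
      case True
      define N where "N = {g. \<forall>i<n. g \<bullet> \<phi> i = 0}"
      have "subspace N" by (auto simp: N_def subspace_def inner_add_left)
      moreover have "T g \<in> N" if "g \<in> N" for g
      proof -
        have "T g \<bullet> \<phi> i = 0" if i: "i < n" for i
        proof -
          obtain r where "T (\<phi> i) = r *\<^sub>R \<phi> i" using IH[OF i] i True by (auto simp: P_def)
          then show ?thesis using \<open>g \<in> N\<close> i by (simp add: sym N_def)
        qed
        then show ?thesis by (simp add: N_def)
      qed
      moreover have "\<exists>f\<in>N. f \<noteq> 0"
      proof -
        have "dim (\<phi> ` {..<n}) \<le> card (\<phi> ` {..<n})" by (rule dim_le_card') simp
        also have "\<dots> \<le> n" using card_image_le[of "{..<n}" \<phi>] by simp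
        finally have "dim (\<phi> ` {..<n}) < DIM('a)" using True by simp
        then obtain f where "f \<noteq> 0" "\<And>y. y \<in> span (\<phi> ` {..<n}) \<Longrightarrow> orthogonal f y"
          by (rule orthogonal_to_subspace_exists) blast
        then have "f \<in> N" by (simp add: N_def orthogonal_def span_base)
        with \<open>f \<noteq> 0\<close> show ?thesis by blast
      qed
      ultimately have "\<exists>f\<in>N. norm f = 1 \<and>
          (\<exists>r. T f = r *\<^sub>R f \<and> (\<forall>g\<in>N. T g \<bullet> g \<le> r * (norm g)\<^sup>2))"
        by (intro top_eigenvector_euclidean T sym)
      then obtain f where "f \<in> N" "norm f = 1"
        "\<exists>r. T f = r *\<^sub>R f \<and> (\<forall>g\<in>N. T g \<bullet> g \<le> r * (norm g)\<^sup>2)"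
        by (elim bexE conjE)
      then have "P \<phi> n f" by (simp add: P_def N_def)
      then show ?thesis ..
    qed (simp add: P_def)
  qed
  then obtain v where v: "\<And>n. P v n (v n)" by blast
  then have "\<forall>n. \<exists>r. n < DIM('a) \<longrightarrow> T (v n) = r *\<^sub>R v n \<and>
      (\<forall>g. (\<forall>i<n. g \<bullet> v i = 0) \<longrightarrow> T g \<bullet> g \<le> r * (norm g)\<^sup>2)"
    by (auto simp: P_def)
  then obtain s where s: "\<And>n. n < DIM('a) \<Longrightarrow> T (v n) = s n *\<^sub>R v n \<and>
      (\<forall>g. (\<forall>i<n. g \<bullet> v i = 0) \<longrightarrow> T g \<bullet> g \<le> s n * (norm g)\<^sup>2)"
    by metis
  have lt: "v j \<bullet> v i = 0" if "i < j" "j < DIM('a)" for i j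
    using v[of j] that by (simp add: P_def)
  have norm: "norm (v i) = 1" if "i < DIM('a)" for i using v[of i] that by (simp add: P_def)
  show ?thesis
  proof (rule that)
    show "v i \<bullet> v j = (if i = j then 1 else 0)" if "i < DIM('a)" "j < DIM('a)" for i j
      using lt[of i j] lt[of j i] norm[of i] that
      by (cases i j rule: linorder_cases) (auto simp: inner_commute dot_square_norm)
    show "T (v i) = s i *\<^sub>R v i" if "i < DIM('a)" for i using s[OF that] by simp
    show "s j \<le> s i" if "i \<le> j" "j < DIM('a)" for i j
    proof -
      have "\<forall>k<i. v j \<bullet> v k = 0" using lt that by simp
      then have "T (v j) \<bullet> v j \<le> s i * (norm (v j))\<^sup>2" using s[of i] that by simp
      then show ?thesis using s[OF that(2)] norm[OF that(2)] by (simp add: dot_square_norm)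
    qed
  qed
qed

text \<open>As many orthonormal vectors as the dimension must span, and \<open>x\<close> minus its
  expansion is orthogonal to all of them, hence to itself.\<close>

lemma orthonormal_family_expansion:
  fixes v :: "nat \<Rightarrow> 'a::euclidean_space"
  assumes on: "\<And>i j. i < DIM('a) \<Longrightarrow> j < DIM('a) \<Longrightarrow> v i \<bullet> v j = (if i = j then 1 else 0)"
  shows "span (v ` {..<DIM('a)}) = UNIV" and "x = (\<Sum>i<DIM('a). (v i \<bullet> x) *\<^sub>R v i)"
    and "inj_on v {..<DIM('a)}" and "independent (v ` {..<DIM('a)})"
proof -
  show inj: "inj_on v {..<DIM('a)}"
    by (rule inj_onI) (metis on lessThan_iff zero_neq_one)
  have "pairwise orthogonal (v ` {..<DIM('a)})"
    by (auto simp: pairwise_def orthogonal_def on)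
  moreover have "0 \<notin> v ` {..<DIM('a)}" using on by force
  ultimately show indep: "independent (v ` {..<DIM('a)})" by (rule pairwise_orthogonal_independent)
  have "UNIV \<subseteq> span (v ` {..<DIM('a)})"
    using indep inj by (intro card_ge_dim_independent) (auto simp: card_image)
  then show span: "span (v ` {..<DIM('a)}) = UNIV" by blast
  let ?y = "x - (\<Sum>i<DIM('a). (v i \<bullet> x) *\<^sub>R v i)"
  have "v j \<bullet> ?y = 0" if "j < DIM('a)" for j
  proof -
    have "(\<Sum>i<DIM('a). (v i \<bullet> x) * (v j \<bullet> v i)) = (\<Sum>i<DIM('a). if i = j then v i \<bullet> x else 0)"
      using that on by (intro sum.cong) auto
    then show ?thesis using that by (simp add: inner_diff_right inner_sum_right)
  qed
  then have "orthogonal ?y y" if "y \<in> v ` {..<DIM('a)}" for y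
    using that by (auto simp: orthogonal_def inner_commute)
  then have "orthogonal ?y ?y"
    using span by (intro orthogonal_to_span[of ?y "v ` {..<DIM('a)}" ?y]) simp_all
  then show "x = (\<Sum>i<DIM('a). (v i \<bullet> x) *\<^sub>R v i)" by (simp add: orthogonal_self)
qed

text \<open>A sum of rank-one terms makes symmetry and non-negativity of \<open>X X^T\<close>
  visible.\<close>

lemma mult_transpose_mult:
  fixes X :: "real^'n^'d"
  shows "(X ** transpose X) *v y = (\<Sum>i\<in>UNIV. (column i X \<bullet> y) *\<^sub>R column i X)"
proof -
  have *: "(transpose X *v y) $ i = column i X \<bullet> y" for i
    by (simp add: matrix_vector_mult_def transpose_def column_def inner_vec_def)
  have "(X ** transpose X) *v y = X *v (transpose X *v y)" by (rule matrix_vector_mul_assoc[symmetric])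
  also have "\<dots> = (\<Sum>i\<in>UNIV. (column i X \<bullet> y) *\<^sub>R column i X)"
    by (simp only: matrix_mult_sum[of X "transpose X *v y"] * scalar_mult_eq_scaleR)
  finally show ?thesis .
qed

lemma gram_symmetric:
  fixes X :: "real^'n^'d"
  shows "((X ** transpose X) *v f) \<bullet> g = f \<bullet> ((X ** transpose X) *v g)"
  by (simp add: mult_transpose_mult inner_sum_left inner_sum_right mult.commute inner_commute)

text \<open>An orthonormal eigenbasis repeats each eigenvalue as often as the dimension of its
  eigenspace, so ordering it decreasingly realizes the counting definition.\<close>

lemma singular_value_eq:
  fixes X :: "real^'n^'d" and v :: "nat \<Rightarrow> real^'d"
  assumes on: "\<And>i j. i < CARD('d) \<Longrightarrow> j < CARD('d) \<Longrightarrow> v i \<bullet> v j = (if i = j then 1 else 0)"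
    and eig: "\<And>i. i < CARD('d) \<Longrightarrow> (X ** transpose X) *v v i = s i *\<^sub>R v i"
    and dec: "\<And>i j. i \<le> j \<Longrightarrow> j < CARD('d) \<Longrightarrow> s j \<le> s i"
    and i: "i < CARD('d)"
  shows "singular_value X (Suc i) = sqrt (s i)" and "0 \<le> s i"
proof -
  let ?M = "X ** transpose X" and ?d = "CARD('d)"
  have on': "\<And>i j. i < DIM(real^'d) \<Longrightarrow> j < DIM(real^'d) \<Longrightarrow> v i \<bullet> v j = (if i = j then 1 else 0)"
    using on by simp
  note basis = orthonormal_family_expansion[OF on', simplified]
  \<comment> \<open>Pairing with \<open>v j\<close> on either side shows that an eigenvector has no
    component along those of other eigenvalues.\<close>
  have coeff: "s j * (v j \<bullet> f) = t * (v j \<bullet> f)" if "?M *v f = t *\<^sub>R f" "j < ?d" for f t j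
    using gram_symmetric[of X f "v j"] that(1) eig[OF that(2)] by (auto simp: inner_commute)
  have eigsp: "sym_eigenspace ?M t = span (v ` {j\<in>{..<?d}. s j = t})" for t
  proof
    show "sym_eigenspace ?M t \<subseteq> span (v ` {j\<in>{..<?d}. s j = t})"
    proof
      fix f assume "f \<in> sym_eigenspace ?M t"
      then have "v j \<bullet> f = 0" if "j < ?d" "s j \<noteq> t" for j
        using coeff[of f t j] that by (auto simp: sym_eigenspace_def)
      then have "(v j \<bullet> f) *\<^sub>R v j \<in> span (v ` {j\<in>{..<?d}. s j = t})" if "j < ?d" for j
      proof (cases "s j = t")
        case True
        then show ?thesis using that by (intro span_scale span_base) simp
      qed (use that in \<open>simp add: span_zero\<close>)
      then have "(\<Sum>j<?d. (v j \<bullet> f) *\<^sub>R v j) \<in> span (v ` {j\<in>{..<?d}. s j = t})"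
        by (intro span_sum) auto
      then show "f \<in> span (v ` {j\<in>{..<?d}. s j = t})" using basis(2)[of f] by simp
    qed
    have "subspace (sym_eigenspace ?M t)"
      by (auto simp: subspace_def sym_eigenspace_def matrix_vector_right_distrib
          matrix_vector_mult_scaleR scaleR_right_distrib)
    then show "span (v ` {j\<in>{..<?d}. s j = t}) \<subseteq> sym_eigenspace ?M t"
      by (intro span_minimal) (auto simp: sym_eigenspace_def eig)
  qed
  have dim: "dim (sym_eigenspace ?M t) = card {j\<in>{..<?d}. s j = t}" for t
  proof -
    have "independent (v ` {j\<in>{..<?d}. s j = t})" "inj_on v {j\<in>{..<?d}. s j = t}"
      by (rule independent_mono[OF basis(4)], blast, rule inj_on_subset[OF basis(3)], blast)
    then show ?thesis unfolding eigsp by (simp add: dim_eq_card_independent card_image)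
  qed
  have ev: "(\<exists>f\<in>sym_eigenspace ?M t. f \<noteq> 0) \<longleftrightarrow> t \<in> s ` {..<?d}" for t
  proof -
    have "(\<exists>f\<in>sym_eigenspace ?M t. f \<noteq> 0) \<longleftrightarrow> dim (sym_eigenspace ?M t) \<noteq> 0"
      by (auto simp: dim_eq_0)
    then show ?thesis unfolding dim by auto
  qed
  have num: "num_eigenvalues_ge ?M t = card {j\<in>{..<?d}. t \<le> s j}" for t
  proof -
    have "{r. (\<exists>f\<in>sym_eigenspace ?M r. f \<noteq> 0) \<and> t \<le> r} = s ` {j\<in>{..<?d}. t \<le> s j}"
      unfolding ev by auto
    moreover have "{j\<in>{..<?d}. s j = r} = {j\<in>{j\<in>{..<?d}. t \<le> s j}. s j = r}"
      if "r \<in> s ` {j\<in>{..<?d}. t \<le> s j}" for r using that by auto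
    ultimately show ?thesis
      unfolding num_eigenvalues_ge_def dim
      using card_eq_sum_fibres[of "{j\<in>{..<?d}. t \<le> s j}" s] by simp
  qed
  have "(GREATEST t. Suc i \<le> num_eigenvalues_ge ?M t) = s i"
    unfolding num
  proof (rule Greatest_equality)
    have "{..i} \<subseteq> {j\<in>{..<?d}. s i \<le> s j}" using i dec by auto
    then show "Suc i \<le> card {j\<in>{..<?d}. s i \<le> s j}"
      using card_mono[of "{j\<in>{..<?d}. s i \<le> s j}" "{..i}"] by simp
    show "t \<le> s i" if "Suc i \<le> card {j\<in>{..<?d}. t \<le> s j}" for t
    proof (rule ccontr)
      assume "\<not> t \<le> s i"
      then have "s j < t" if "i \<le> j" "j < ?d" for j using dec[OF that] by simp
      then have "{j\<in>{..<?d}. t \<le> s j} \<subseteq> {..<i}" by (force simp flip: not_less)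
      then have "card {j\<in>{..<?d}. t \<le> s j} \<le> card {..<i}" by (intro card_mono) auto
      then show False using that by simp
    qed
  qed
  then show "singular_value X (Suc i) = sqrt (s i)" by (simp add: singular_value_def)
  have "s i = (?M *v v i) \<bullet> v i" using eig[OF i] on[OF i i] by simp
  also have "\<dots> = (\<Sum>k\<in>UNIV. (column k X \<bullet> v i)\<^sup>2)"
    by (simp add: mult_transpose_mult inner_sum_left power2_eq_square)
  finally show "0 \<le> s i" by (simp add: sum_nonneg)
qed

lemma gram_eigenbasis:
  fixes X :: "real^'n^'d"
  obtains v :: "nat \<Rightarrow> real^'d"
  where "\<And>i j. i < CARD('d) \<Longrightarrow> j < CARD('d) \<Longrightarrow> v i \<bullet> v j = (if i = j then 1 else 0)"
    "\<And>i. i < CARD('d) \<Longrightarrow> (X ** transpose X) *v v i = (singular_value X (Suc i))\<^sup>2 *\<^sub>R v i"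
    "\<And>i j. i \<le> j \<Longrightarrow> j < CARD('d) \<Longrightarrow> singular_value X (Suc j) \<le> singular_value X (Suc i)"
    "\<And>i. i < CARD('d) \<Longrightarrow> 0 \<le> singular_value X (Suc i)"
proof -
  have "linear ((*v) (X ** transpose X))" by (rule matrix_vector_mul_linear)
  then obtain v :: "nat \<Rightarrow> real^'d" and s where v:
    "\<And>i j. i < CARD('d) \<Longrightarrow> j < CARD('d) \<Longrightarrow> v i \<bullet> v j = (if i = j then 1 else 0)"
    "\<And>i. i < CARD('d) \<Longrightarrow> (X ** transpose X) *v v i = s i *\<^sub>R v i"
    "\<And>i j. i \<le> j \<Longrightarrow> j < CARD('d) \<Longrightarrow> s j \<le> s i"
    using symmetric_eigenbasis[of "(*v) (X ** transpose X)"] gram_symmetric[of X] by auto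
  show ?thesis
    by (rule that[of v]) (use v singular_value_eq[OF v] in simp_all)
qed

lemma singular_value_nonneg:
  fixes X :: "real^'n^'d"
  assumes "i < CARD('d)"
  shows "0 \<le> singular_value X (Suc i)"
  by (rule gram_eigenbasis[of X]) (use assms in simp)

lemma singular_value_antimono:
  fixes X :: "real^'n^'d"
  assumes "i \<le> j" "j < CARD('d)"
  shows "singular_value X (Suc j) \<le> singular_value X (Suc i)"
  by (rule gram_eigenbasis[of X]) (use assms in simp)

lemma exists_left_singular_basis:
  fixes X :: "real^'n^'d"
  shows "\<exists>u. left_singular_basis X u"
proof -
  obtain v :: "nat \<Rightarrow> real^'d" where v:
    "\<And>i j. i < CARD('d) \<Longrightarrow> j < CARD('d) \<Longrightarrow> v i \<bullet> v j = (if i = j then 1 else 0)"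
    "\<And>i. i < CARD('d) \<Longrightarrow> (X ** transpose X) *v v i = (singular_value X (Suc i))\<^sup>2 *\<^sub>R v i"
    by (rule gram_eigenbasis[of X]) blast
  define u where "u i = v (i - 1)" for i
  have "u ` {1..CARD('d)} = v ` {..<CARD('d)}"
    unfolding u_def by (force simp: image_iff intro: bexI[of _ "Suc _"])
  moreover have "span (v ` {..<CARD('d)}) = UNIV"
    using orthonormal_family_expansion(1)[of v] v(1) by simp
  moreover have "(X ** transpose X) *v u i = (singular_value X i)\<^sup>2 *\<^sub>R u i" if "i \<in> {1..CARD('d)}" for i
    using v(2)[of "i - 1"] that by (cases i) (simp_all add: u_def)
  moreover have "u i \<bullet> u j = (if i = j then 1 else 0)" if "i \<in> {1..CARD('d)}" "j \<in> {1..CARD('d)}" for i j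
    using v(1)[of "i - 1" "j - 1"] that by (auto simp: u_def)
  ultimately have "left_singular_basis X u" unfolding left_singular_basis_def by simp
  then show ?thesis by (rule exI[where x = u])
qed

section \<open>The minimization problem\<close>

text \<open>The boundary term disappears once \<open>s\<close> is continued by zero at
  \<open>m\<close>.\<close>

lemma abel_summation:
  fixes s f :: "nat \<Rightarrow> 'a::comm_ring"
  shows "(\<Sum>k<m. (s k - s (Suc k)) * (\<Sum>j\<le>k. f j)) = (\<Sum>j<m. s j * f j) - s m * (\<Sum>j<m. f j)"
  by (induction m) (simp_all add: algebra_simps flip: lessThan_Suc_atMost)

context eigenbasis
begin

section \<open>Ky Fan's inequality with decreasing weights\<close>

context
  fixes d :: nat and s :: "nat \<Rightarrow> real" and \<psi> :: "nat \<Rightarrow> ell2" and E :: real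
  assumes \<psi>: "\<And>i j. i < d \<Longrightarrow> j < d \<Longrightarrow> cinner (\<psi> i) (\<psi> j) = (if i = j then 1 else 0)"
    and s_nonneg: "\<And>j. j < d \<Longrightarrow> 0 \<le> s j"
    and s_dec: "\<And>i j. i \<le> j \<Longrightarrow> j < d \<Longrightarrow> s j \<le> s i"
    and E: "(\<lambda>n. lam n * (\<Sum>j<d. s j * (cmod (cinner (\<psi> j) (e n)))\<^sup>2)) sums E"
begin

abbreviation (input) "w j n \<equiv> (cmod (cinner (\<psi> j) (e n)))\<^sup>2"
abbreviation (input) "W k n \<equiv> (\<Sum>j\<le>k. w j n)"

text \<open>Any threshold \<open>\<mu> k\<close> between \<^term>\<open>lam k\<close> and \<^term>\<open>lam (Suc k)\<close> yields the lower bound;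
  the midpoint makes the equality case sharp even if these two eigenvalues coincide.\<close>

definition \<mu> :: "nat \<Rightarrow> real" where "\<mu> k = (lam k + lam (Suc k)) / 2"

text \<open>The contribution of index \<open>n\<close> to the difference of the two sides of Ky
  Fan's inequality for \<open>k\<close>: in the sum over \<open>n\<close> the thresholds cancel, as
  \<open>W k\<close> sums to \<open>Suc k\<close>.\<close>

definition excess :: "nat \<Rightarrow> nat \<Rightarrow> real" where
  "excess k n = (lam n - \<mu> k) * W k n + (if n \<le> k then \<mu> k - lam n else 0)"

text \<open>The weights of summation by parts. Continuing \<open>s\<close> by zero from
  \<open>d\<close> on removes the boundary term and makes the last weight
  \<open>s (d - 1)\<close>.\<close>

definition decrement :: "nat \<Rightarrow> real" where
  "decrement k = (if k < d then s k else 0) - (if Suc k < d then s (Suc k) else 0)"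

lemma decrement_nonneg: "k < d \<Longrightarrow> 0 \<le> decrement k"
  using s_nonneg s_dec[of k "Suc k"] by (simp add: decrement_def)

lemma sum_decrement: "(\<Sum>k<d. decrement k * (\<Sum>j\<le>k. f j)) = (\<Sum>j<d. s j * f j)"
  using abel_summation[of "\<lambda>k. if k < d then s k else 0" f d] by (simp add: decrement_def)

text \<open>Bessel for the orthonormal family \<open>\<psi>\<close>, applied to the unit vector
  \<open>e n\<close>.\<close>

lemma W_le_1:
  assumes "k < d"
  shows "W k n \<le> 1"
proof -
  have "(\<Sum>j\<in>{..k}. (cmod (cinner (e n) (\<psi> j)))\<^sup>2) \<le> (norm (e n))\<^sup>2"
    using assms by (intro bessel_inequality) (simp_all add: \<psi>)
  moreover have "(norm (e n))\<^sup>2 = 1"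
    using Re_cinner_self[of "e n"] by (simp add: orthonormal)
  moreover have "cmod (cinner (e n) f) = cmod (cinner f (e n))" for f
    by (subst cinner_commute) simp
  ultimately show ?thesis by simp
qed

text \<open>Here Parseval in the basis \<open>e\<close> is applied to each unit vector
  \<open>\<psi> j\<close>.\<close>

lemma W_sums:
  assumes "k < d"
  shows "W k sums (Suc k)"
proof -
  have "w j sums 1" if "j \<in> {..k}" for j
    using parseval_norm[of "\<psi> j"] \<psi>[of j j] that assms Re_cinner_self[of "\<psi> j"] by simp
  then have "W k sums (\<Sum>j\<le>k. 1)" by (rule sums_sum)
  then show ?thesis by simp
qed

text \<open>Up to \<open>k\<close> the excess is \<open>(\<mu> k - lam n) * (1 - W k n)\<close>,
  beyond \<open>k\<close> it is \<open>(lam n - \<mu> k) * W k n\<close>, with non-negative factors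
  in both cases.\<close>

lemma excess_nonneg:
  assumes "k < d"
  shows "0 \<le> excess k n"
proof (cases "n \<le> k")
  case True
  then have "lam n \<le> \<mu> k"
    using incseqD[OF lam_mono True] incseqD[OF lam_mono, of k "Suc k"] by (simp add: \<mu>_def)
  then have "0 \<le> (\<mu> k - lam n) * (1 - W k n)"
    using W_le_1[OF assms, of n] by (intro mult_nonneg_nonneg) auto
  then show ?thesis using True by (simp add: excess_def algebra_simps)
next
  case False
  then have "\<mu> k \<le> lam n"
    using incseqD[OF lam_mono, of "Suc k" n] incseqD[OF lam_mono, of k "Suc k"] by (simp add: \<mu>_def)
  then show ?thesis using False by (simp add: excess_def sum_nonneg)
qed

text \<open>The sum over \<open>k\<close> is taken first, because convergence is known for the
  weighted series only; if some \<open>s j\<close> vanish, the series for a single \<open>k\<close>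
  may diverge.\<close>

lemma excess_sums: "(\<lambda>n. \<Sum>k<d. decrement k * excess k n) sums (E - (\<Sum>j<d. s j * lam j))"
proof -
  have eq: "(\<Sum>k<d. decrement k * excess k n) = lam n * (\<Sum>j<d. s j * w j n) -
      (\<Sum>k<d. decrement k * \<mu> k * W k n) + (\<Sum>k<d. decrement k * (if n \<in> {..k} then \<mu> k - lam n else 0))" for n
  proof -
    have "lam n * (\<Sum>j<d. s j * w j n) = (\<Sum>k<d. lam n * (decrement k * W k n))"
      by (simp only: sum_decrement[symmetric] sum_distrib_left)
    then show ?thesis
      by (simp add: excess_def distrib_left left_diff_distrib right_diff_distrib sum.distrib sum_subtractf mult_ac)
  qed
  have "(\<lambda>n. \<Sum>k<d. decrement k * excess k n) sums
      (E - (\<Sum>k<d. decrement k * \<mu> k * Suc k) + (\<Sum>k<d. decrement k * (\<Sum>n\<in>{..k}. \<mu> k - lam n)))"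
    unfolding eq
    by (intro sums_add sums_diff E sums_sum sums_mult W_sums sums_If_finite_set) simp_all
  moreover have "(\<Sum>k<d. decrement k * (\<Sum>n\<in>{..k}. \<mu> k - lam n)) =
      (\<Sum>k<d. decrement k * \<mu> k * Suc k) - (\<Sum>j<d. s j * lam j)"
    unfolding sum_decrement[symmetric] by (simp add: sum_subtractf algebra_simps)
  ultimately show ?thesis by simp
qed

lemma weighted_sum_le: "(\<Sum>j<d. s j * lam j) \<le> E"
proof -
  have "0 \<le> E - (\<Sum>j<d. s j * lam j)"
    by (rule sums_le[OF _ sums_zero excess_sums])
      (intro sum_nonneg mult_nonneg_nonneg; simp add: decrement_nonneg excess_nonneg)
  then show ?thesis by simp
qed

text \<open>Equality makes a series of non-negative terms vanish, and positive decrements then make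
  every excess zero. If \<open>lam n < lam k\<close>, the vectors before \<open>\<psi> k\<close>
  already exhaust Bessel's bound at \<open>e n\<close>; if \<open>lam n > lam k\<close>,
  \<open>W k n\<close> itself is zero.\<close>

lemma equality_imp_orthogonal:
  assumes eq: "E = (\<Sum>j<d. s j * lam j)"
    and pos: "\<And>j. j < d \<Longrightarrow> 0 < s j" and strict: "\<And>j. Suc j < d \<Longrightarrow> s (Suc j) < s j"
    and k: "k < d" and n: "lam n \<noteq> lam k"
  shows "cinner (\<psi> k) (e n) = 0"
proof -
  have nonneg: "0 \<le> decrement k * excess k n" if "k < d" for k n
    using that by (intro mult_nonneg_nonneg decrement_nonneg excess_nonneg)
  define t where "t n = (\<Sum>k<d. decrement k * excess k n)" for n
  have "t sums 0" unfolding t_def using excess_sums eq by simp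
  moreover have t0: "0 \<le> t n" for n unfolding t_def using nonneg by (intro sum_nonneg) simp
  ultimately have "t n = 0" for n
    using suminf_eq_zero_iff[of t] by (simp add: sums_iff)
  then have "decrement k * excess k n = 0" if "k < d" for k n
    using that nonneg sum_nonneg_eq_0_iff[of "{..<d}" "\<lambda>k. decrement k * excess k n"]
    by (auto simp: t_def)
  moreover have "decrement k \<noteq> 0" if "k < d" for k
    using that pos[of k] strict[of k] by (auto simp: decrement_def)
  ultimately have excess_0: "excess k n = 0" if "k < d" for k n using that by auto
  show ?thesis
  proof (cases "lam n < lam k")
    case True
    then have "n < k" using incseqD[OF lam_mono, of k n] by (meson not_le)
    define m where "m = k - 1"
    have m: "k = Suc m" "n \<le> m" using \<open>n < k\<close> by (auto simp: m_def)
    \<comment> \<open>With the midpoint, \<open>lam n < lam (Suc m)\<close> suffices for strictness,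
      even if \<open>lam n = lam m\<close>.\<close>
    have "lam n < \<mu> m" using incseqD[OF lam_mono m(2)] True by (simp add: \<mu>_def m(1))
    moreover have "(\<mu> m - lam n) * (1 - W m n) = 0"
      using excess_0[of m n] k m by (simp add: excess_def algebra_simps)
    ultimately have "W m n = 1" by simp
    moreover have "W k n = W m n + w k n" by (simp add: m(1))
    ultimately have "w k n \<le> 0" using W_le_1[OF k, of n] by simp
    then show ?thesis by simp
  next
    case False
    then have lt: "lam k < lam n" using n by simp
    then have "k < n" using incseqD[OF lam_mono, of n k] by (meson not_le)
    then have "\<mu> k < lam n" using incseqD[OF lam_mono, of "Suc k" n] lt by (simp add: \<mu>_def)
    moreover have "(lam n - \<mu> k) * W k n = 0"
      using excess_0[OF k, of n] \<open>k < n\<close> by (simp add: excess_def)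
    ultimately have "W k n = 0" by simp
    then have "w k n = 0" by (subst (asm) sum_nonneg_eq_0_iff) auto
    then show ?thesis by simp
  qed
qed

end

end

text \<open>A real functional is the pairing with some vector \<open>a\<close>, and the sum of its
  squares over the columns is the form of \<open>X X^T\<close> at \<open>a\<close>, which is
  diagonal in \<open>v\<close>. Real and imaginary parts of \<open>c\<close> are treated
  separately.\<close>

lemma sum_cmod_sq_columns:
  fixes X :: "real^'n^'d" and v :: "nat \<Rightarrow> real^'d" and c :: "real^'d \<Rightarrow> complex"
  assumes on: "\<And>i j. i < CARD('d) \<Longrightarrow> j < CARD('d) \<Longrightarrow> v i \<bullet> v j = (if i = j then 1 else 0)"
    and eig: "\<And>i. i < CARD('d) \<Longrightarrow> (X ** transpose X) *v v i = s i *\<^sub>R v i"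
    and c: "linear c"
  shows "(\<Sum>i\<in>UNIV. (cmod (c (column i X)))\<^sup>2) = (\<Sum>j<CARD('d). s j * (cmod (c (v j)))\<^sup>2)"
proof -
  let ?d = "CARD('d)"
  have expand: "y = (\<Sum>j<?d. (v j \<bullet> y) *\<^sub>R v j)" for y
    using orthonormal_family_expansion(2)[of v y] on by simp
  have real: "(\<Sum>i\<in>UNIV. (g (column i X))\<^sup>2) = (\<Sum>j<?d. s j * (g (v j))\<^sup>2)"
    if g: "linear g" for g :: "real^'d \<Rightarrow> real"
  proof -
    define a where "a = (\<Sum>j<?d. g (v j) *\<^sub>R v j)"
    have ga: "g y = a \<bullet> y" for y
    proof -
      have "g y = g (\<Sum>j<?d. (v j \<bullet> y) *\<^sub>R v j)" by (rule arg_cong[OF expand])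
      also have "\<dots> = a \<bullet> y"
        by (simp add: linear_sum[OF g] linear_cmul[OF g] a_def inner_sum_left mult.commute)
      finally show ?thesis .
    qed
    have "(\<Sum>i\<in>UNIV. (g (column i X))\<^sup>2) = ((X ** transpose X) *v a) \<bullet> a"
      by (simp add: mult_transpose_mult inner_sum_left inner_sum_right ga power2_eq_square inner_commute)
    also have "(X ** transpose X) *v a = (\<Sum>j<?d. g (v j) *\<^sub>R ((X ** transpose X) *v v j))"
      unfolding a_def
      by (simp add: linear_sum[OF matrix_vector_mul_linear] matrix_vector_mult_scaleR)
    also have "\<dots> = (\<Sum>j<?d. (g (v j) * s j) *\<^sub>R v j)" by (intro sum.cong) (simp_all add: eig)
    also have "\<dots> \<bullet> a = (\<Sum>j<?d. s j * (g (v j))\<^sup>2)"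
      by (simp add: inner_sum_left inner_sum_right ga power2_eq_square inner_commute mult_ac)
    finally show ?thesis .
  qed
  have "linear (\<lambda>y. Re (c y))" "linear (\<lambda>y. Im (c y))"
    using c by (auto simp: linear_iff)
  then show ?thesis
    using real[of "\<lambda>y. Re (c y)"] real[of "\<lambda>y. Im (c y)"]
    by (simp add: cmod_power2 sum.distrib distrib_left)
qed

section \<open>Isometries and their energy in a basis of singular vectors\<close>

lemma left_singular_basisD:
  fixes X :: "real^'n^'d"
  assumes "left_singular_basis X u"
  shows "i < CARD('d) \<Longrightarrow> j < CARD('d) \<Longrightarrow> u (Suc i) \<bullet> u (Suc j) = (if i = j then 1 else 0)"
    and "i < CARD('d) \<Longrightarrow>
      (X ** transpose X) *v u (Suc i) = (singular_value X (Suc i))\<^sup>2 *\<^sub>R u (Suc i)"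
  using assms by (simp_all add: left_singular_basis_def)

lemma isometries_orthonormal:
  fixes X :: "real^'n^'d"
  assumes "\<Phi> \<in> isometries" "left_singular_basis X u" "i < CARD('d)" "j < CARD('d)"
  shows "cinner (\<Phi> (u (Suc i))) (\<Phi> (u (Suc j))) = (if i = j then 1 else 0)"
  using assms left_singular_basisD(1)[OF assms(2-4)] by (simp add: isometries_def)

text \<open>Both sides of the isometry identity reduce to the same sum of products of coordinates
  along \<open>u\<close>.\<close>

lemma spectral_embedding_in_isometries:
  fixes u :: "nat \<Rightarrow> real^'d"
  assumes u: "\<And>i j. i < CARD('d) \<Longrightarrow> j < CARD('d) \<Longrightarrow> u (Suc i) \<bullet> u (Suc j) = (if i = j then 1 else 0)"
    and \<phi>: "\<And>i j. i < CARD('d) \<Longrightarrow> j < CARD('d) \<Longrightarrow> cinner (\<phi> (Suc i)) (\<phi> (Suc j)) = (if i = j then 1 else 0)"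
  shows "spectral_embedding u \<phi> \<in> isometries"
    and "j < CARD('d) \<Longrightarrow> spectral_embedding u \<phi> (u (Suc j)) = \<phi> (Suc j)"
proof -
  let ?d = "CARD('d)"
  have emb: "spectral_embedding u \<phi> y = (\<Sum>j<?d. (u (Suc j) \<bullet> y) *\<^sub>R \<phi> (Suc j))" for y
    by (simp add: spectral_embedding_def sum.atLeast1_atMost_eq)
  show "spectral_embedding u \<phi> (u (Suc j)) = \<phi> (Suc j)" if "j < ?d"
  proof -
    have "spectral_embedding u \<phi> (u (Suc j)) = (\<Sum>i<?d. if i = j then \<phi> (Suc i) else 0)"
      unfolding emb using u that by (intro sum.cong) auto
    then show ?thesis using that by simp
  qed
  have "linear (spectral_embedding u \<phi>)"
    by (rule linearI) (simp_all add: emb inner_add_right scaleR_add_left sum.distrib scaleR_sum_right)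
  moreover have "cinner (spectral_embedding u \<phi> y) (spectral_embedding u \<phi> z) = of_real (y \<bullet> z)" for y z
  proof -
    have coeff: "cinner (\<phi> (Suc i)) (spectral_embedding u \<phi> z) = of_real (u (Suc i) \<bullet> z)" if "i < ?d" for i
    proof -
      have "cinner (\<phi> (Suc i)) (spectral_embedding u \<phi> z) =
          (\<Sum>j<?d. if j = i then of_real (u (Suc j) \<bullet> z) else 0)"
        unfolding emb cinner.sum_right using \<phi> that
        by (intro sum.cong) (auto simp: cinner.scaleR_right scaleR_conv_of_real)
      then show ?thesis using that by simp
    qed
    have "cinner (spectral_embedding u \<phi> y) (spectral_embedding u \<phi> z) =
        (\<Sum>i<?d. of_real (u (Suc i) \<bullet> y) * cinner (\<phi> (Suc i)) (spectral_embedding u \<phi> z))"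
      unfolding emb[of y] by (simp add: cinner.sum_left cinner.scaleR_left scaleR_conv_of_real)
    also have "\<dots> = of_real (\<Sum>i<?d. (u (Suc i) \<bullet> y) * (u (Suc i) \<bullet> z))"
      by (simp add: coeff)
    also have "(\<Sum>i<?d. (u (Suc i) \<bullet> y) * (u (Suc i) \<bullet> z)) = y \<bullet> (\<Sum>i<?d. (u (Suc i) \<bullet> z) *\<^sub>R u (Suc i))"
      by (simp add: inner_sum_right inner_commute mult.commute)
    also have "(\<Sum>i<?d. (u (Suc i) \<bullet> z) *\<^sub>R u (Suc i)) = z"
      using orthonormal_family_expansion(2)[of "\<lambda>i. u (Suc i)" z] u by simp
    finally show ?thesis .
  qed
  ultimately show "spectral_embedding u \<phi> \<in> isometries" by (simp add: isometries_def)
qed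

text \<open>Exchanges the data points for singular vectors, separately for each \<open>e n\<close>.
  The basis \<open>u\<close> stays arbitrary, since the claim on minimizers concerns every choice of
  it.\<close>

lemma (in eigenbasis) energy_eq_iff:
  fixes X :: "real^'n^'d"
  assumes X: "X = (\<chi> r i. x i $ r)" and u: "left_singular_basis X u" and \<Phi>: "linear \<Phi>" and E: "0 \<le> E"
  shows "energy A x \<Phi> = ennreal E \<longleftrightarrow>
    (\<lambda>n. lam n * (\<Sum>j<CARD('d). (singular_value X (Suc j))\<^sup>2 *
      (cmod (cinner (\<Phi> (u (Suc j))) (e n)))\<^sup>2)) sums E"
proof -
  have col: "column i X = x i" for i by (simp add: X column_def vec_eq_iff)
  have lin: "linear (\<lambda>y. cinner (\<Phi> y) (e n))" for n
    using \<Phi> by (auto simp: linear_iff cinner.add_left cinner.scaleR_left)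
  have "(\<Sum>i\<in>UNIV. (cmod (cinner (\<Phi> (x i)) (e n)))\<^sup>2) =
      (\<Sum>j<CARD('d). (singular_value X (Suc j))\<^sup>2 * (cmod (cinner (\<Phi> (u (Suc j))) (e n)))\<^sup>2)" for n
    using sum_cmod_sq_columns[OF left_singular_basisD[OF u] lin[of n]] by (simp add: col)
  then show ?thesis
    unfolding energy_def by (subst sum_quadratic_form_eq) (simp_all add: E)
qed

theorem theorem1:
  fixes x :: "'n::finite \<Rightarrow> real^'d"
    and X :: "real^'n^'d"
    and A :: "ell2 \<rightharpoonup> ell2"
  assumes X: "X = (\<chi> r i. x i $ r)"
    and "self_adjoint A"
    and "positive_semidefinite A"
    and "purely_discrete_spectrum A"
  shows
    "(\<forall>\<Phi>\<in>isometries. energy A x \<Phi> \<ge>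
        ennreal (\<Sum>i=1..CARD('d). lowest_eigenvalue A i * (singular_value X i)\<^sup>2)) \<and>
     (\<forall>u \<phi>. left_singular_basis X u \<and> lowest_eigenvectors A CARD('d) \<phi> \<longrightarrow>
        spectral_embedding u \<phi> \<in> isometries \<and>
        energy A x (spectral_embedding u \<phi>) =
          ennreal (\<Sum>i=1..CARD('d). lowest_eigenvalue A i * (singular_value X i)\<^sup>2)) \<and>
     (inj_on (singular_value X) {1..CARD('d)} \<and>
      (\<forall>i\<in>{1..CARD('d)}. singular_value X i \<noteq> 0) \<longrightarrow>
        (\<forall>\<Phi>. is_arg_min (energy A x) (\<lambda>\<Psi>. \<Psi> \<in> isometries) \<Phi> \<longrightarrow>
          (\<exists>u. left_singular_basis X u) \<and>
          (\<forall>u. left_singular_basis X u \<longrightarrow>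
            (\<exists>\<phi>. lowest_eigenvectors A CARD('d) \<phi> \<and> \<Phi> = spectral_embedding u \<phi>))))"
proof -
  let ?d = "CARD('d)"
  obtain e lam where "orthonormal_basis e" and A_e: "\<And>n. A (e n) = Some (lam n *\<^sub>R e n)"
    and lam: "\<And>n. 0 \<le> lam n" "incseq lam" "filterlim lam at_top sequentially"
    by (rule exists_eigenbasis[OF assms(2-4)]) blast
  then interpret orthonormal_basis e by simp
  interpret eigenbasis e A lam
    by unfold_locales (use self_adjoint_eq_diag_op[OF assms(2) A_e] lam in auto)
  define s where "s j = (singular_value X (Suc j))\<^sup>2" for j
  define v where "v = (\<Sum>j<?d. s j * lam j)"
  have v0: "0 \<le> v" by (simp add: v_def s_def sum_nonneg lam_nonneg)
  have v: "(\<Sum>i=1..?d. lowest_eigenvalue A i * (singular_value X i)\<^sup>2) = v"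
    by (simp add: v_def s_def sum.atLeast1_atMost_eq lowest_eigenvalue_eq mult.commute)
  have s_dec: "s j \<le> s i" if "i \<le> j" "j < ?d" for i j
    unfolding s_def using that by (intro power_mono singular_value_antimono singular_value_nonneg)
  have \<Phi>D: "linear \<Phi>" if "\<Phi> \<in> isometries" for \<Phi> :: "real^'d \<Rightarrow> ell2"
    using that by (simp add: isometries_def)
  note energy = energy_eq_iff[OF X _ \<Phi>D, folded s_def]
  obtain u0 where u0: "left_singular_basis X u0" using exists_left_singular_basis[of X] by blast

  have lower: "ennreal v \<le> energy A x \<Phi>" if \<Phi>: "\<Phi> \<in> isometries" for \<Phi>
  proof (cases "energy A x \<Phi>")
    \<comment> \<open>Only a finite energy needs Ky Fan's inequality, for which one fixed singular
      basis suffices.\<close>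
    case (real E)
    then have "(\<lambda>n. lam n * (\<Sum>j<?d. s j * (cmod (cinner (\<Phi> (u0 (Suc j))) (e n)))\<^sup>2)) sums E"
      using energy[OF u0 \<Phi>] by simp
    then have "v \<le> E"
      unfolding v_def
      using weighted_sum_le[of ?d "\<lambda>j. \<Phi> (u0 (Suc j))" s E]
        isometries_orthonormal[OF \<Phi> u0] s_dec
      by (simp add: s_def)
    then show ?thesis using real by (simp add: ennreal_leI)
  qed simp

  have upper: "spectral_embedding u \<phi> \<in> isometries" "energy A x (spectral_embedding u \<phi>) = ennreal v"
    if u: "left_singular_basis X u" and \<phi>: "lowest_eigenvectors A ?d \<phi>" for u \<phi>
  proof -
    have on: "cinner (\<phi> (Suc i)) (\<phi> (Suc j)) = (if i = j then 1 else 0)" if "i < ?d" "j < ?d" for i j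
      using \<phi> that by (simp add: lowest_eigenvectors_def)
    \<comment> \<open>\<open>\<phi> (Suc j)\<close> may differ from \<open>e j\<close> if
      eigenvalues repeat. Still, \<open>lam n\<close> can be replaced by \<open>lam j\<close> in
      every non-zero term, and Parseval evaluates the energy.\<close>
    have \<phi>_perp: "cinner (\<phi> (Suc j)) (e n) = 0" if "j < ?d" "lam n \<noteq> lam j" for j n
      using \<phi> that by (simp add: lowest_eigenvectors_def lowest_eigenvalue_eq eigenspace_iff)
    note emb = spectral_embedding_in_isometries[OF left_singular_basisD(1)[OF u] on]
    show iso: "spectral_embedding u \<phi> \<in> isometries" by (rule emb(1))
    have "(\<lambda>n. s j * (lam j * (cmod (cinner (\<phi> (Suc j)) (e n)))\<^sup>2)) sums (s j * (lam j * 1))" if "j < ?d" for j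
      using parseval_norm[of "\<phi> (Suc j)"] on[OF that that] Re_cinner_self[of "\<phi> (Suc j)"]
      by (intro sums_mult) simp
    then have "(\<lambda>n. \<Sum>j<?d. s j * (lam j * (cmod (cinner (\<phi> (Suc j)) (e n)))\<^sup>2)) sums (\<Sum>j<?d. s j * (lam j * 1))"
      by (intro sums_sum) simp
    moreover have "(\<Sum>j<?d. s j * (lam j * (cmod (cinner (\<phi> (Suc j)) (e n)))\<^sup>2)) =
        lam n * (\<Sum>j<?d. s j * (cmod (cinner (spectral_embedding u \<phi> (u (Suc j))) (e n)))\<^sup>2)" for n
      unfolding sum_distrib_left
    proof (intro sum.cong refl)
      fix j assume "j \<in> {..<?d}"
      then show "s j * (lam j * (cmod (cinner (\<phi> (Suc j)) (e n)))\<^sup>2) =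
          lam n * (s j * (cmod (cinner (spectral_embedding u \<phi> (u (Suc j))) (e n)))\<^sup>2)"
        using \<phi>_perp[of j n] by (cases "lam n = lam j") (simp_all add: emb(2))
    qed
    ultimately show "energy A x (spectral_embedding u \<phi>) = ennreal v"
      unfolding energy[OF u iso v0] by (simp add: v_def)
  qed

  \<comment> \<open>The eigenbasis itself provides an embedding that attains the bound, so every
    minimizer has energy \<open>v\<close>.\<close>
  have "lowest_eigenvectors A ?d (\<lambda>i. e (i - 1))"
    unfolding lowest_eigenvectors_def
  proof (intro conjI ballI)
    fix i assume i: "i \<in> {1..?d}"
    then show "e (i - 1) \<in> eigenspace A (of_real (lowest_eigenvalue A i))"
      by (cases i) (auto simp: lowest_eigenvalue_eq eigenspace_iff orthonormal)
    fix j assume "j \<in> {1..?d}"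
    with i show "cinner (e (i - 1)) (e (j - 1)) = (if i = j then 1 else 0)"
      by (auto simp: orthonormal)
  qed
  note attained = upper[OF u0 this]

  have minimizer: "\<exists>\<phi>. lowest_eigenvectors A ?d \<phi> \<and> \<Phi> = spectral_embedding u \<phi>"
    if inj: "inj_on (singular_value X) {1..?d}" and nz: "\<forall>i\<in>{1..?d}. singular_value X i \<noteq> 0"
      and min: "is_arg_min (energy A x) (\<lambda>\<Psi>. \<Psi> \<in> isometries) \<Phi>" and u: "left_singular_basis X u" for \<Phi> u
  proof -
    have \<Phi>: "\<Phi> \<in> isometries" using min by (simp add: is_arg_min_def)
    have "\<not> energy A x (spectral_embedding u0 (\<lambda>i. e (i - 1))) < energy A x \<Phi>"
      using min attained(1) by (simp add: is_arg_min_def)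
    then have "energy A x \<Phi> = ennreal v" using attained(2) lower[OF \<Phi>] by simp
    then have sums: "(\<lambda>n. lam n * (\<Sum>j<?d. s j * (cmod (cinner (\<Phi> (u (Suc j))) (e n)))\<^sup>2)) sums v"
      using energy[OF u \<Phi> v0] by simp
    have pos: "0 < s j" if "j < ?d" for j using nz that by (auto simp: s_def)
    have strict: "s (Suc j) < s j" if "Suc j < ?d" for j
    proof -
      have "singular_value X (Suc (Suc j)) \<noteq> singular_value X (Suc j)"
        using inj_onD[OF inj, of "Suc (Suc j)" "Suc j"] that by auto
      then have "s (Suc j) \<noteq> s j"
        using singular_value_nonneg[of j X] singular_value_nonneg[of "Suc j" X] that
        by (simp add: s_def)
      then show ?thesis using s_dec[of j "Suc j"] that by simp
    qed
    note on = isometries_orthonormal[OF \<Phi> u]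
    have perp: "cinner (\<Phi> (u (Suc j))) (e n) = 0" if "j < ?d" "lam n \<noteq> lam j" for j n
      using equality_imp_orthogonal[of ?d "\<lambda>j. \<Phi> (u (Suc j))" s v j n] on s_dec pos strict sums that
      by (simp add: v_def less_imp_le)
    \<comment> \<open>The witness is forced: a spectral embedding sends \<open>u i\<close> to
      \<open>\<phi> i\<close>.\<close>
    have "lowest_eigenvectors A ?d (\<lambda>i. \<Phi> (u i))"
      unfolding lowest_eigenvectors_def
    proof (intro conjI ballI)
      fix i assume i: "i \<in> {1..?d}"
      then show "\<Phi> (u i) \<in> eigenspace A (of_real (lowest_eigenvalue A i))"
        by (cases i) (auto simp: lowest_eigenvalue_eq eigenspace_iff perp)
      fix j assume "j \<in> {1..?d}"
      with i show "cinner (\<Phi> (u i)) (\<Phi> (u j)) = (if i = j then 1 else 0)"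
        using on[of "i - 1" "j - 1"] by (cases i; cases j) auto
    qed
    moreover have "\<Phi> y = spectral_embedding u (\<lambda>i. \<Phi> (u i)) y" for y
    proof -
      have "\<Phi> y = \<Phi> (\<Sum>j<?d. (u (Suc j) \<bullet> y) *\<^sub>R u (Suc j))"
        using orthonormal_family_expansion(2)[of "\<lambda>i. u (Suc i)" y] left_singular_basisD(1)[OF u] by simp
      also have "\<dots> = spectral_embedding u (\<lambda>i. \<Phi> (u i)) y"
        by (simp add: linear_sum[OF \<Phi>D[OF \<Phi>]] linear_cmul[OF \<Phi>D[OF \<Phi>]] spectral_embedding_def
            sum.atLeast1_atMost_eq)
      finally show ?thesis .
    qed
    ultimately show ?thesis by blast
  qed
  show ?thesis unfolding v using lower upper minimizer u0 by blast
qed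

end
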